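(* Let $F=\mathbb{F}_q$ be a finite field of characteristic not $2$, let $L$ be a quadratic extension of $F$, and let $\sigma$ be the generator of $\mathrm{Gal}(L/F)$. For $a\in L\setminus F$ put $A_a:=(L/F,\sigma,a)$. Then $\mathrm{Aut}(A_a)$ is either the cyclic group of order $q+1$ or the dicyclic group of order $2q+2$.
   Context: For a quadratic Galois extension $L/F$ with nontrivial automorphism $\sigma$ and $a\in L\setminus F$, the nonassociative cyclic algebra $(L/F,\sigma,a)$ is the $L$-vector space $L\oplus Lz$ with multiplication $(x_0+x_1z)(y_0+y_1z)=(x_0y_0+x_1\sigma(y_1)a)+(x_0y_1+x_1\sigma(y_0))z$ for $x_0,x_1,y_0,y_1\in L$. $\mathrm{Aut}$ denotes the group of $F$-algebra automorphisms. The dicyclic group of order $4n$ is $\mathrm{Dic}_n=\langle x,y\mid y^{2n}=1,\ x^2=y^n,\ x^{-1}yx=y^{-1}\rangle$; the one of order $2q+2$ is $\mathrm{Dic}_n$ with $n=(q+1)/2$. *)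

theory Defs
  imports "HOL-Algebra.Algebra"
begin

section \<open>Automorphism groups\<close>

definition ring_char :: "('a, 'm) ring_scheme \<Rightarrow> nat" where
  "ring_char R = group.ord (add_monoid R) \<one>\<^bsub>R\<^esub>"

definition galois_group :: "('a, 'm) ring_scheme \<Rightarrow> 'a set \<Rightarrow> ('a \<Rightarrow> 'a) monoid" where
  "galois_group L F =
     BijGroup (carrier L)
       \<lparr>carrier := {f \<in> ring_hom L L \<inter> Bij (carrier L). \<forall>c\<in>F. f c = c}\<rparr>"

text \<open>
  The record type of modules, which has a multiplication and a scalar multiplication, also
  serves for algebras that need not be associative: neither it nor \<^const>\<open>ring_hom\<close> presupposes
  any axioms. The first argument is the ring of scalars.
\<close>

definition algebra_Aut ::
  "('k, 'm) ring_scheme \<Rightarrow> ('k, 'a, 'n) module_scheme \<Rightarrow> ('a \<Rightarrow> 'a) monoid" where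
  "algebra_Aut K A =
     BijGroup (carrier A)
       \<lparr>carrier := {f \<in> ring_hom A A \<inter> Bij (carrier A).
          \<forall>c\<in>carrier K. \<forall>x\<in>carrier A. f (c \<odot>\<^bsub>A\<^esub> x) = c \<odot>\<^bsub>A\<^esub> f x}\<rparr>"

section \<open>Nonassociative cyclic algebras of degree two\<close>

text \<open>The pair \<open>(x\<^sub>0, x\<^sub>1)\<close> stands for \<open>x\<^sub>0 + x\<^sub>1 z\<close>.\<close>

definition nonassoc_cyclic_algebra ::
  "('a, 'm) ring_scheme \<Rightarrow> ('a \<Rightarrow> 'a) \<Rightarrow> 'a \<Rightarrow> ('a, 'a \<times> 'a) module" where
  "nonassoc_cyclic_algebra L \<sigma> a =
     \<lparr>carrier = carrier L \<times> carrier L,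
      monoid.mult = (\<lambda>(x0, x1) (y0, y1).
        ((x0 \<otimes>\<^bsub>L\<^esub> y0) \<oplus>\<^bsub>L\<^esub> (x1 \<otimes>\<^bsub>L\<^esub> \<sigma> y1 \<otimes>\<^bsub>L\<^esub> a),
         (x0 \<otimes>\<^bsub>L\<^esub> y1) \<oplus>\<^bsub>L\<^esub> (x1 \<otimes>\<^bsub>L\<^esub> \<sigma> y0))),
      one = (\<one>\<^bsub>L\<^esub>, \<zero>\<^bsub>L\<^esub>),
      ring.zero = (\<zero>\<^bsub>L\<^esub>, \<zero>\<^bsub>L\<^esub>),
      ring.add = (\<lambda>(x0, x1) (y0, y1). (x0 \<oplus>\<^bsub>L\<^esub> y0, x1 \<oplus>\<^bsub>L\<^esub> y1)),
      module.smult = (\<lambda>c (x0, x1). (c \<otimes>\<^bsub>L\<^esub> x0, c \<otimes>\<^bsub>L\<^esub> x1))\<rparr>"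

section \<open>Groups given by generators and relations\<close>

text \<open>
  A letter \<open>(g, True)\<close> stands for the generator \<open>g\<close> and \<open>(g, False)\<close> for its inverse. A pair
  \<open>(r, s)\<close> of words in \<open>R\<close> is the relation \<open>r = s\<close>, and \<open>word_eq R\<close> is the least congruence on
  words that contains \<open>R\<close> and cancels a letter against its inverse. Every element of the type
  \<open>'g\<close> is a generator.
\<close>

type_synonym 'g word = "('g \<times> bool) list"

inductive word_eq :: "('g word \<times> 'g word) set \<Rightarrow> 'g word \<Rightarrow> 'g word \<Rightarrow> bool"
  for R where
  refl: "word_eq R u u"
| sym: "word_eq R u v \<Longrightarrow> word_eq R v u"
| trans: "word_eq R u v \<Longrightarrow> word_eq R v w \<Longrightarrow> word_eq R u w"
| cancel: "word_eq R (u @ [(g, b), (g, \<not> b)] @ v) (u @ v)"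
| relation: "(r, s) \<in> R \<Longrightarrow> word_eq R (u @ r @ v) (u @ s @ v)"

definition presented_group :: "('g word \<times> 'g word) set \<Rightarrow> 'g word set monoid" where
  "presented_group R =
     \<lparr>carrier = UNIV // {(u, v). word_eq R u v},
      monoid.mult = (\<lambda>A B. {w. \<exists>u\<in>A. \<exists>v\<in>B. word_eq R (u @ v) w}),
      one = {w. word_eq R [] w}\<rparr>"

datatype dicyclic_gen = Gen_x | Gen_y

definition dicyclic_group :: "nat \<Rightarrow> dicyclic_gen word set monoid" where
  "dicyclic_group n =
     (let x = (Gen_x, True); x_inv = (Gen_x, False);
          y = (Gen_y, True); y_inv = (Gen_y, False)
      in presented_group
           {(replicate (2 * n) y, []),
            ([x, x], replicate n y),
            ([x_inv, y, x], [y_inv])})"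

end

theory Submission
  imports Defs
begin

text \<open>
  The left nucleus of \<open>A\<^sub>a\<close> is \<open>L\<close>, so an automorphism restricts to some \<open>\<tau> \<in> {id, \<sigma>}\<close> on \<open>L\<close>. Comparing
  the images of \<open>z a = \<sigma>(a) z\<close> and \<open>z z = a\<close> shows that it maps \<open>z\<close> to \<open>l z\<close> with
  \<open>l \<sigma>(l) a = \<tau>(a)\<close>, and conversely each such pair \<open>(\<tau>, l)\<close> defines an automorphism. For \<open>\<tau> = id\<close> the
  condition is \<open>l \<sigma>(l) = 1\<close>; by Hilbert 90 the solutions form a quotient of the cyclic group \<open>L\<^sup>*\<close> by
  \<open>F\<^sup>*\<close>, of order \<open>(q\<^sup>2 - 1) / (q - 1) = q + 1\<close>. For \<open>\<tau> = \<sigma>\<close> the condition forces \<open>l \<sigma>(l) = -1\<close>; if it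
  has a solution, the group is twice as large and satisfies the dicyclic relations, where \<open>x\<close> is any
  \<open>(\<sigma>, l)\<close> and \<open>y\<close> is \<open>(id, g)\<close> for a generator \<open>g\<close> of the norm one group. The dicyclic presentation
  admits at most \<open>4n\<close> elements, so the resulting surjection is an isomorphism.
\<close>

section \<open>Groups given by presentations\<close>

definition word_class :: "('g word \<times> 'g word) set \<Rightarrow> 'g word \<Rightarrow> 'g word set" where
  "word_class R u = {v. word_eq R u v}"

definition word_inv :: "'g word \<Rightarrow> 'g word" where
  "word_inv u = rev (map (\<lambda>(g, b). (g, \<not> b)) u)"

text \<open>The rules \<open>cancel\<close> and \<open>relation\<close> carry arbitrary contexts, so
  a prefix \<open>w\<close> is absorbed into \<open>u\<close>. With the analogous fact for suffixes,
  concatenation descends to classes.\<close>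

lemma word_eq_append_left: "word_eq R u v \<Longrightarrow> word_eq R (w @ u) (w @ v)"
proof (induction rule: word_eq.induct)
  case (trans u v w)
  then show ?case by (blast intro: word_eq.trans)
next
  case (cancel u g b v)
  show ?case using word_eq.cancel[of R "w @ u" g b v] by simp
next
  case (relation r s u v)
  then show ?case using word_eq.relation[of r s R "w @ u" v] by simp
qed (auto intro: word_eq.refl word_eq.sym)

lemma word_eq_append_right: "word_eq R u v \<Longrightarrow> word_eq R (u @ w) (v @ w)"
proof (induction rule: word_eq.induct)
  case (trans u v w)
  then show ?case by (blast intro: word_eq.trans)
next
  case (cancel u g b v)
  show ?case using word_eq.cancel[of R u g b "v @ w"] by simp
next
  case (relation r s u v)
  then show ?case using word_eq.relation[of r s R u "v @ w"] by simp
qed (auto intro: word_eq.refl word_eq.sym)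

lemma word_eq_append: "word_eq R u u' \<Longrightarrow> word_eq R v v' \<Longrightarrow> word_eq R (u @ v) (u' @ v')"
  by (meson word_eq.trans word_eq_append_left word_eq_append_right)

lemma word_class_eq_iff: "word_class R u = word_class R v \<longleftrightarrow> word_eq R u v"
  unfolding word_class_def by (auto intro: word_eq.refl word_eq.sym word_eq.trans)

lemma word_eq_word_inv: "word_eq R (word_inv u @ u) []"
proof (induction u)
  case (Cons l u)
  obtain g b where l: "l = (g, b)" by force
  \<comment> \<open>The inverse of \<open>l\<close> ends \<open>word_inv (l # u)\<close> and so
    meets \<open>l\<close>; the cancelled pair starts with the sign \<open>\<not> b\<close>.\<close>
  have "word_eq R (word_inv (l # u) @ l # u) (word_inv u @ u)"
    using word_eq.cancel[of R "word_inv u" g "\<not> b" u] by (simp add: word_inv_def l)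
  with Cons.IH show ?case by (blast intro: word_eq.trans)
qed (simp add: word_inv_def word_eq.refl)

lemma carrier_presented_group: "carrier (presented_group R) = range (word_class R)"
  by (auto simp: presented_group_def quotient_def word_class_def)

lemma one_presented_group: "\<one>\<^bsub>presented_group R\<^esub> = word_class R []"
  by (simp add: presented_group_def word_class_def)

lemma mult_presented_group:
  "word_class R u \<otimes>\<^bsub>presented_group R\<^esub> word_class R v = word_class R (u @ v)"
  unfolding presented_group_def word_class_def
  by (auto intro: word_eq.refl word_eq.trans word_eq_append)

lemma word_class_in_carrier: "word_class R u \<in> carrier (presented_group R)"
  by (simp add: carrier_presented_group)

lemma group_presented_group: "group (presented_group R)"
proof (rule groupI)
  fix A assume "A \<in> carrier (presented_group R)"
  then obtain u where "A = word_class R u"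
    by (auto simp: carrier_presented_group)
  then show "\<exists>B\<in>carrier (presented_group R). B \<otimes>\<^bsub>presented_group R\<^esub> A = \<one>\<^bsub>presented_group R\<^esub>"
    by (intro bexI[of _ "word_class R (word_inv u)"])
      (simp_all add: mult_presented_group one_presented_group word_class_in_carrier
        word_class_eq_iff word_eq_word_inv)
qed (auto simp: carrier_presented_group one_presented_group mult_presented_group)

lemma inv_presented_group:
  "inv\<^bsub>presented_group R\<^esub> (word_class R u) = word_class R (word_inv u)"
proof -
  interpret group "presented_group R" by (rule group_presented_group)
  show ?thesis
    by (rule inv_equality)
      (simp_all add: mult_presented_group one_presented_group word_class_in_carrier
        word_class_eq_iff word_eq_word_inv)
qed

lemma pow_presented_group:
  "word_class R [l] [^]\<^bsub>presented_group R\<^esub> (k::nat) = word_class R (replicate k l)"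
  by (induction k)
    (simp_all add: one_presented_group mult_presented_group replicate_append_same)

section \<open>Evaluation of words in a group and homomorphisms out of presented groups\<close>

context group
begin

definition letter_value :: "('g \<Rightarrow> 'a) \<Rightarrow> 'g \<times> bool \<Rightarrow> 'a" where
  "letter_value f l = (if snd l then f (fst l) else inv f (fst l))"

definition word_value :: "('g \<Rightarrow> 'a) \<Rightarrow> 'g word \<Rightarrow> 'a" where
  "word_value f u = foldr (\<lambda>l. (\<otimes>) (letter_value f l)) u \<one>"

lemma word_value_Nil [simp]: "word_value f [] = \<one>"
  by (simp add: word_value_def)

lemma word_value_Cons [simp]: "word_value f (l # u) = letter_value f l \<otimes> word_value f u"
  by (simp add: word_value_def)

lemma letter_value_closed [simp]: "range f \<subseteq> carrier G \<Longrightarrow> letter_value f l \<in> carrier G"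
  by (auto simp: letter_value_def)

lemma word_value_closed [simp]: "range f \<subseteq> carrier G \<Longrightarrow> word_value f u \<in> carrier G"
  by (induction u) simp_all

lemma word_value_append:
  "range f \<subseteq> carrier G \<Longrightarrow> word_value f (u @ v) = word_value f u \<otimes> word_value f v"
  by (induction u) (simp_all add: m_assoc)

lemma word_value_replicate:
  assumes "range f \<subseteq> carrier G"
  shows "word_value f (replicate k l) = letter_value f l [^] k"
  using assms by (induction k) (simp_all add: nat_pow_Suc2[symmetric] del: nat_pow_Suc)

text \<open>A cancelling pair evaluates to an element times its inverse, and the relations hold in
  the group by assumption, so evaluation respects every rule generating
  \<open>word_eq\<close>.\<close>

lemma word_value_cong:
  assumes f: "range f \<subseteq> carrier G"
    and R: "\<And>r s. (r, s) \<in> R \<Longrightarrow> word_value f r = word_value f s"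
    and uv: "word_eq R u v"
  shows "word_value f u = word_value f v"
  using uv
proof (induction rule: word_eq.induct)
  case (cancel u g b v)
  have "f g \<in> carrier G" using f by auto
  then have "word_value f [(g, b), (g, \<not> b)] = \<one>"
    by (simp add: letter_value_def)
  then show ?case
    using f by (simp only: word_value_append word_value_closed l_one)
next
  case (relation r s u v)
  then show ?case using f R by (simp add: word_value_append)
qed simp_all

text \<open>Von Dyck's theorem. Evaluating an arbitrarily chosen representative is well defined
  because evaluation is constant on classes.\<close>

lemma presented_group_hom:
  assumes f: "range f \<subseteq> carrier G"
    and R: "\<And>r s. (r, s) \<in> R \<Longrightarrow> word_value f r = word_value f s"
  obtains h where "h \<in> hom (presented_group R) G" "\<And>u. h (word_class R u) = word_value f u"
proof -
  define h where "h A = word_value f (SOME u. u \<in> A)" for A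
  have h: "h (word_class R u) = word_value f u" for u
  proof -
    have "u \<in> word_class R u"
      by (simp add: word_class_def word_eq.refl)
    then have "(SOME v. v \<in> word_class R u) \<in> word_class R u"
      by (rule someI)
    then show ?thesis
      unfolding h_def using word_value_cong[OF f R] by (auto simp: word_class_def)
  qed
  have "h \<in> hom (presented_group R) G"
    by (rule homI)
      (auto simp: carrier_presented_group mult_presented_group h word_value_append f)
  then show thesis using h that by blast
qed

section \<open>Consequences of the dicyclic relations in an arbitrary group\<close>

lemma dicyclic_int_pow_swap:
  assumes x: "x \<in> carrier G" and y: "y \<in> carrier G" and conj: "inv x \<otimes> y \<otimes> x = inv y"
  shows "x \<otimes> y [^] (k::int) = y [^] (- k) \<otimes> x"
proof -
  have hom: "(\<lambda>g. x \<otimes> g \<otimes> inv x) \<in> hom G G"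
    by (rule homI) (use x in \<open>simp_all add: m_assoc flip: m_assoc[of "inv x" x]\<close>)
  interpret c: group_hom G G "\<lambda>g. x \<otimes> g \<otimes> inv x"
    by unfold_locales (rule hom)
  \<comment> \<open>The hypothesis conjugates by \<open>inv x\<close>. Rewriting it as
    \<open>x \<otimes> inv y \<otimes> inv x = y\<close> and inverting gives the conjugate by
    \<open>x\<close>; conjugation is a homomorphism, so this extends to all powers.\<close>
  have "y \<otimes> x = x \<otimes> inv y"
    using conj x y by (metis inv_closed inv_solve_left m_assoc m_closed)
  then have "x \<otimes> inv y \<otimes> inv x = y"
    using x y by (metis inv_closed inv_solve_right m_closed)
  then have "x \<otimes> y \<otimes> inv x = inv y"
    using x y by (metis c.hom_inv inv_inv inv_closed)
  then have "x \<otimes> y [^] k \<otimes> inv x = inv y [^] k"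
    using c.hom_int_pow[OF y, of k] by simp
  also have "\<dots> = y [^] (- k)"
    using y by (metis int_pow_inv int_pow_neg)
  finally show ?thesis
    using x y by (metis int_pow_closed inv_closed inv_solve_right' m_closed)
qed

text \<open>Moving each \<open>x\<close> to the right inverts the powers of \<open>y\<close> that it
  passes, and \<open>x \<otimes> x\<close> is itself a power of \<open>y\<close>, so at most one
  \<open>x\<close> survives. Integer exponents treat inverses uniformly; they are reduced modulo
  \<open>2 * n\<close> only at the end.\<close>

lemma dicyclic_normal_form:
  assumes x: "x \<in> carrier G" and y: "y \<in> carrier G" and n: "0 < n"
    and y_pow: "y [^] (2 * n :: nat) = \<one>" and x_sq: "x \<otimes> x = y [^] n"
    and conj: "inv x \<otimes> y \<otimes> x = inv y"
    and u: "u \<in> generate G {x, y}"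
  obtains i :: nat where "i < 2 * n" "u = y [^] i \<or> u = y [^] i \<otimes> x"
proof -
  note swap = dicyclic_int_pow_swap[OF x y conj]
  have x_sq': "x \<otimes> x = y [^] int n"
    by (simp add: x_sq int_pow_int)
  have swap': "x \<otimes> (y [^] k \<otimes> v) = y [^] (- k) \<otimes> (x \<otimes> v)" if "v \<in> carrier G" for k :: int and v
    using swap[of k] x y that by (simp flip: m_assoc)
  have add: "y [^] j \<otimes> (y [^] k \<otimes> v) = y [^] (j + k) \<otimes> v" if "v \<in> carrier G" for j k :: int and v
    using y that by (simp flip: m_assoc int_pow_mult)
  have "\<exists>i::int. u = y [^] i \<or> u = y [^] i \<otimes> x"
    using u
  proof (induction rule: generate.induct)
    case one
    show ?case by (intro exI[of _ 0]) simp
  next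
    case (incl h)
    moreover have "x = y [^] (0::int) \<otimes> x" using x by simp
    moreover have "y = y [^] (1::int)" using y by simp
    ultimately show ?case by blast
  next
    case (inv h)
    have "inv x = y [^] (- int n) \<otimes> x"
    proof (rule inv_equality)
      show "y [^] (- int n) \<otimes> x \<otimes> x = \<one>"
        using x y by (simp add: m_assoc x_sq' flip: int_pow_mult)
    qed (use x y in simp_all)
    moreover have "inv y = y [^] (- 1 :: int)" using y by (simp add: int_pow_neg)
    ultimately show ?case using inv by blast
  next
    case (eng h1 h2)
    then obtain i j :: int where
      "h1 = y [^] i \<or> h1 = y [^] i \<otimes> x" "h2 = y [^] j \<or> h2 = y [^] j \<otimes> x" by blast
    moreover have "y [^] i \<otimes> y [^] j = y [^] (i + j)"
      "y [^] i \<otimes> (y [^] j \<otimes> x) = y [^] (i + j) \<otimes> x"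
      "y [^] i \<otimes> x \<otimes> y [^] j = y [^] (i - j) \<otimes> x"
      using x y by (simp_all add: m_assoc swap swap' add flip: int_pow_mult)
    \<comment> \<open>The first \<open>x\<close> turns \<open>y [^] j\<close> into
      \<open>y [^] (- j)\<close>, and the two copies of \<open>x\<close> then merge into
      \<open>y [^] n\<close>.\<close>
    moreover have "y [^] i \<otimes> x \<otimes> (y [^] j \<otimes> x) = y [^] (i + (int n - j))"
      using x y by (simp add: m_assoc swap' add x_sq' flip: int_pow_mult)
    ultimately show ?case by metis
  qed
  then obtain i :: int where i: "u = y [^] i \<or> u = y [^] i \<otimes> x" by blast
  \<comment> \<open>Multiples of \<open>2 * n\<close> drop out of the exponent, so division with
    remainder yields a natural number below \<open>2 * n\<close>.\<close>
  have "y [^] (int (2 * n) * j) = \<one>" for j :: int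
    using y y_pow by (simp only: int_pow_pow[symmetric] int_pow_int int_pow_one)
  then have "y [^] (int (2 * n) * (i div int (2 * n)) + i mod int (2 * n)) = y [^] (i mod int (2 * n))"
    using y by (simp only: int_pow_mult l_one int_pow_closed)
  then have "y [^] i = y [^] (i mod int (2 * n))"
    by simp
  also have "\<dots> = y [^] nat (i mod int (2 * n))"
    using n by (simp flip: int_pow_int)
  finally have "y [^] i = y [^] nat (i mod int (2 * n))" .
  moreover have "nat (i mod int (2 * n)) < 2 * n"
    using n by (simp add: nat_less_iff)
  ultimately show thesis using i that by metis
qed

lemma card_le_dicyclic:
  assumes x: "x \<in> carrier G" and y: "y \<in> carrier G" and n: "0 < n"
    and y_pow: "y [^] (2 * n :: nat) = \<one>" and x_sq: "x \<otimes> x = y [^] n"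
    and conj: "inv x \<otimes> y \<otimes> x = inv y"
    and gen: "carrier G \<subseteq> generate G {x, y}"
  shows "finite (carrier G)" "order G \<le> 4 * n"
proof -
  let ?A = "(\<lambda>i. y [^] i) ` {..<2 * n}" and ?B = "(\<lambda>i. y [^] i \<otimes> x) ` {..<2 * n}"
  have sub: "carrier G \<subseteq> ?A \<union> ?B"
  proof
    fix u assume "u \<in> carrier G"
    then obtain i where "i < 2 * n" "u = y [^] i \<or> u = y [^] i \<otimes> x"
      using dicyclic_normal_form[OF x y n y_pow x_sq conj] gen by blast
    then show "u \<in> ?A \<union> ?B" by blast
  qed
  then show "finite (carrier G)" by (rule finite_subset) simp
  have "order G \<le> card (?A \<union> ?B)"
    unfolding order_def by (rule card_mono[OF _ sub]) simp
  also have "\<dots> \<le> card ?A + card ?B" by (rule card_Un_le)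
  also have "\<dots> \<le> 2 * n + 2 * n"
    by (rule add_mono) (metis card_image_le card_lessThan finite_lessThan)+
  finally show "order G \<le> 4 * n" by simp
qed

end

section \<open>The dicyclic group: a bound on its order and a criterion for isomorphism\<close>

definition dicyclic_rels :: "nat \<Rightarrow> (dicyclic_gen word \<times> dicyclic_gen word) set" where
  "dicyclic_rels n =
     {(replicate (2 * n) (Gen_y, True), []),
      ([(Gen_x, True), (Gen_x, True)], replicate n (Gen_y, True)),
      ([(Gen_x, False), (Gen_y, True), (Gen_x, True)], [(Gen_y, False)])}"

lemma dicyclic_group_eq: "dicyclic_group n = presented_group (dicyclic_rels n)"
  by (simp add: dicyclic_group_def dicyclic_rels_def Let_def)

text \<open>The classes of the two generators satisfy the relations and generate the group, so the
  normal form bounds its order. The upper bound suffices for \<open>iso_dicyclic_group\<close>,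
  where a group of order \<open>4 * n\<close> is given as an image.\<close>

lemma card_dicyclic_group_le:
  assumes n: "0 < n"
  shows "finite (carrier (dicyclic_group n))" "order (dicyclic_group n) \<le> 4 * n"
proof -
  let ?R = "dicyclic_rels n"
  let ?D = "presented_group ?R"
  define x where "x = word_class ?R [(Gen_x, True)]"
  define y where "y = word_class ?R [(Gen_y, True)]"
  interpret D: group ?D by (rule group_presented_group)
  have x: "x \<in> carrier ?D" and y: "y \<in> carrier ?D"
    by (simp_all add: x_def y_def word_class_in_carrier)
  have inv_x: "inv\<^bsub>?D\<^esub> x = word_class ?R [(Gen_x, False)]"
    and inv_y: "inv\<^bsub>?D\<^esub> y = word_class ?R [(Gen_y, False)]"
    by (simp_all add: x_def y_def inv_presented_group word_inv_def)
  have rel: "word_class ?R r = word_class ?R s" if "(r, s) \<in> ?R" for r s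
    using word_eq.relation[OF that, of "[]" "[]"] by (simp add: word_class_eq_iff)
  have y_pow: "y [^]\<^bsub>?D\<^esub> (2 * n) = \<one>\<^bsub>?D\<^esub>"
    unfolding y_def pow_presented_group one_presented_group
    by (rule rel) (simp add: dicyclic_rels_def)
  have x_sq: "x \<otimes>\<^bsub>?D\<^esub> x = y [^]\<^bsub>?D\<^esub> n"
    unfolding x_def y_def pow_presented_group mult_presented_group
    by (rule rel) (simp add: dicyclic_rels_def)
  have conj: "inv\<^bsub>?D\<^esub> x \<otimes>\<^bsub>?D\<^esub> y \<otimes>\<^bsub>?D\<^esub> x = inv\<^bsub>?D\<^esub> y"
    unfolding inv_x inv_y unfolding x_def y_def mult_presented_group
    by (rule rel) (simp add: dicyclic_rels_def)
  \<comment> \<open>A class is the product of the classes of its letters, and a single letter is a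
    generator or the inverse of one.\<close>
  have letter: "word_class ?R [l] \<in> generate ?D {x, y}" for l
  proof (cases l)
    case [simp]: (Pair g b)
    have "inv\<^bsub>?D\<^esub> x \<in> generate ?D {x, y}" "inv\<^bsub>?D\<^esub> y \<in> generate ?D {x, y}"
      "x \<in> generate ?D {x, y}" "y \<in> generate ?D {x, y}"
      by (auto intro: generate.intros)
    then show ?thesis
      unfolding Pair inv_x inv_y by (cases g; cases b) (simp_all add: x_def y_def)
  qed
  have "word_class ?R u \<in> generate ?D {x, y}" for u
  proof (induction u)
    case Nil
    show ?case by (simp add: generate.one flip: one_presented_group)
  next
    case (Cons l u)
    then show ?case
      using generate.eng[OF letter[of l] Cons] by (simp add: mult_presented_group)
  qed
  then have gen: "carrier ?D \<subseteq> generate ?D {x, y}"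
    by (auto simp: carrier_presented_group)
  show "finite (carrier (dicyclic_group n))" "order (dicyclic_group n) \<le> 4 * n"
    unfolding dicyclic_group_eq
    using D.card_le_dicyclic[OF x y n y_pow x_sq conj gen] .
qed

text \<open>Von Dyck's theorem gives a homomorphism from \<open>dicyclic_group n\<close>, surjective
  because \<open>x\<close> and \<open>y\<close> generate. The source has at most
  \<open>4 * n\<close> elements and the target exactly that many, so it is injective as
  well.\<close>

lemma (in group) iso_dicyclic_group:
  assumes x: "x \<in> carrier G" and y: "y \<in> carrier G" and n: "0 < n"
    and y_pow: "y [^] (2 * n :: nat) = \<one>" and x_sq: "x \<otimes> x = y [^] n"
    and conj: "inv x \<otimes> y \<otimes> x = inv y"
    and gen: "carrier G \<subseteq> generate G {x, y}" and order: "order G = 4 * n"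
  shows "G \<cong> dicyclic_group n"
proof -
  let ?R = "dicyclic_rels n"
  let ?D = "presented_group ?R"
  interpret D: group ?D by (rule group_presented_group)
  define f where "f = case_dicyclic_gen x y"
  have f: "range f \<subseteq> carrier G"
    using x y by (auto simp: f_def split: dicyclic_gen.split)
  have [simp]: "letter_value f (Gen_x, True) = x" "letter_value f (Gen_x, False) = inv x"
    "letter_value f (Gen_y, True) = y" "letter_value f (Gen_y, False) = inv y"
    by (simp_all add: letter_value_def f_def)
  have "word_value f r = word_value f s" if "(r, s) \<in> ?R" for r s
    using that x y y_pow x_sq conj
    by (auto simp: dicyclic_rels_def word_value_replicate f m_assoc)
  then obtain h where h: "h \<in> hom ?D G" and h_word: "\<And>u. h (word_class ?R u) = word_value f u"
    using presented_group_hom[OF f] by blast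
  interpret h: group_hom ?D G h
    by unfold_locales (rule h)
  have "x = h (word_class ?R [(Gen_x, True)])" "y = h (word_class ?R [(Gen_y, True)])"
    using x y by (simp_all add: h_word)
  then have "{x, y} \<subseteq> h ` carrier ?D"
    using word_class_in_carrier by blast
  then have "generate G {x, y} \<subseteq> h ` carrier ?D"
    by (rule generate_subgroup_incl[OF _ h.subgroup_img_is_subgroup[OF D.subgroup_self]])
  then have surj: "h ` carrier ?D = carrier G"
    using gen h.hom_closed by blast
  moreover have "inj_on h (carrier ?D)"
  proof (rule eq_card_imp_inj_on)
    show fin: "finite (carrier ?D)"
      using card_dicyclic_group_le(1)[OF n] by (simp add: dicyclic_group_eq)
    show "card (h ` carrier ?D) = card (carrier ?D)"
      using card_dicyclic_group_le(2)[OF n] card_image_le[OF fin, of h] order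
      by (simp add: dicyclic_group_eq surj order_def)
  qed
  ultimately have "h \<in> iso ?D G"
    using h by (simp add: iso_def bij_betw_def)
  then show ?thesis
    unfolding dicyclic_group_eq by (metis D.iso_sym is_isoI)
qed

section \<open>Quadratic extensions\<close>

text \<open>One proof serves both automorphism groups: \<open>P\<close> stands for fixing
  \<open>F\<close> pointwise or for \<open>F\<close>-linearity. As associativity fails in the
  algebra, \<open>A\<close> enters only through the closure of its operations.\<close>

lemma subgroup_ring_automorphisms:
  fixes A :: "('a, 'm) ring_scheme"
  assumes closed: "\<one>\<^bsub>A\<^esub> \<in> carrier A"
      "\<And>x y. \<lbrakk>x \<in> carrier A; y \<in> carrier A\<rbrakk> \<Longrightarrow> x \<otimes>\<^bsub>A\<^esub> y \<in> carrier A"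
      "\<And>x y. \<lbrakk>x \<in> carrier A; y \<in> carrier A\<rbrakk> \<Longrightarrow> x \<oplus>\<^bsub>A\<^esub> y \<in> carrier A"
    and P_id: "P (\<lambda>x\<in>carrier A. x)"
    and P_compose: "\<And>f g. \<lbrakk>f \<in> Bij (carrier A); g \<in> Bij (carrier A); P f; P g\<rbrakk>
        \<Longrightarrow> P (compose (carrier A) f g)"
    and P_inv: "\<And>f. \<lbrakk>f \<in> Bij (carrier A); P f\<rbrakk>
        \<Longrightarrow> P (restrict (inv_into (carrier A) f) (carrier A))"
  shows "subgroup {f \<in> ring_hom A A \<inter> Bij (carrier A). P f} (BijGroup (carrier A))"
proof (rule subgroup.intro)
  let ?S = "carrier A"
  let ?H = "{f \<in> ring_hom A A \<inter> Bij ?S. P f}"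
  show "?H \<subseteq> carrier (BijGroup ?S)"
    by (auto simp: BijGroup_def)
  show "\<one>\<^bsub>BijGroup ?S\<^esub> \<in> ?H"
    using closed P_id id_Bij by (auto simp: BijGroup_def intro!: ring_hom_memI)
  show "f \<otimes>\<^bsub>BijGroup ?S\<^esub> g \<in> ?H" if "f \<in> ?H" "g \<in> ?H" for f g
  proof -
    have f: "f \<in> ring_hom A A" "f \<in> Bij ?S" "P f" and g: "g \<in> ring_hom A A" "g \<in> Bij ?S" "P g"
      using that by auto
    have "compose ?S f g \<in> ring_hom A A"
      using f(1) g(1) closed by (intro ring_hom_memI)
        (simp_all add: compose_eq ring_hom_closed ring_hom_mult ring_hom_add ring_hom_one)
    then show ?thesis
      using f g P_compose by (simp add: BijGroup_def compose_Bij)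
  qed
  show "inv\<^bsub>BijGroup ?S\<^esub> f \<in> ?H" if "f \<in> ?H" for f
  proof -
    have f: "f \<in> ring_hom A A" "f \<in> Bij ?S" "P f"
      using that by auto
    have "inv_into ?S f \<one>\<^bsub>A\<^esub> = \<one>\<^bsub>A\<^esub>"
      using f closed(1) ring_hom_one[OF f(1)]
      by (metis Bij_def Int_iff bij_betw_def inv_into_f_f mem_Collect_eq)
    then have "restrict (inv_into ?S f) ?S \<in> ring_hom A A"
      using f closed
      by (intro ring_hom_memI)
        (auto simp: Bij_inv_into_mem Bij_inv_into_lemma ring_hom_mult ring_hom_add)
    then show ?thesis
      using f P_inv by (simp add: inv_BijGroup restrict_inv_into_Bij)
  qed
qed

lemma galois_group_is_group:
  assumes "ring L" and F: "F \<subseteq> carrier L"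
  shows "group (galois_group L F)"
proof -
  interpret ring L by fact
  have "subgroup {f \<in> ring_hom L L \<inter> Bij (carrier L). \<forall>c\<in>F. f c = c} (BijGroup (carrier L))"
  proof (rule subgroup_ring_automorphisms)
    fix f assume f: "f \<in> Bij (carrier L)" "\<forall>c\<in>F. f c = c"
    show "\<forall>c\<in>F. restrict (inv_into (carrier L) f) (carrier L) c = c"
      using f F by (metis (mono_tags, lifting) Bij_def Int_iff bij_betw_def inv_into_f_f
          mem_Collect_eq restrict_apply subsetD)
  qed (use F in \<open>auto simp: compose_eq subset_iff\<close>)
  then show ?thesis
    unfolding galois_group_def by (rule subgroup.subgroup_is_group) (rule group_BijGroup)
qed

section \<open>Coordinates, square roots and conjugation in a quadratic extension\<close>

locale quadratic_extension = field L for L (structure) +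
  fixes F
  assumes subfield: "subfield F L"
    and dim: "dimension 2 F (carrier L)"
    and two_neq_zero: "\<one> \<oplus> \<one> \<noteq> \<zero>"
begin

lemma F_carrier [simp]: "x \<in> F \<Longrightarrow> x \<in> carrier L"
  using subfieldE(3)[OF subfield] by blast

lemma F_closed [simp]:
  "\<zero> \<in> F" "\<one> \<in> F" "x \<in> F \<Longrightarrow> \<ominus> x \<in> F" "\<lbrakk>x \<in> F; y \<in> F\<rbrakk> \<Longrightarrow> x \<otimes> y \<in> F"
  "\<lbrakk>x \<in> F; y \<in> F\<rbrakk> \<Longrightarrow> x \<oplus> y \<in> F" "\<lbrakk>x \<in> F; y \<in> F\<rbrakk> \<Longrightarrow> x \<ominus> y \<in> F"
  using subringE[OF subfieldE(1)[OF subfield]] by (auto simp: a_minus_def)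

lemma F_mult_cancel: "\<lbrakk>k \<in> F; k \<noteq> \<zero>; x \<in> carrier L; k \<otimes> x \<in> F\<rbrakk> \<Longrightarrow> x \<in> F"
  using subfield_m_inv_simprule[OF subfield] by blast

text \<open>As \<open>s\<close> lies outside the span \<open>F\<close> of \<open>\<one>\<close>, the
  list \<open>[s, \<one>]\<close> is independent, and two independent vectors span a space of
  dimension two.\<close>

lemma coordinates_exist:
  assumes s: "s \<in> carrier L - F" and x: "x \<in> carrier L"
  obtains u v where "u \<in> F" "v \<in> F" "x = u \<otimes> s \<oplus> v"
proof -
  have "Span F [\<one>] = F"
    by (auto simp: line_extension_mem_iff)
  then have "independent F [s, \<one>]"
    using s by (intro li_Cons li_Nil) auto
  then have "Span F [s, \<one>] = carrier L"
    using independent_length_eq_dimension[OF subfield dim, of "[s, \<one>]"] s by simp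
  then have "x \<in> line_extension F s F"
    using x \<open>Span F [\<one>] = F\<close> by simp
  then show thesis
    using that by (auto simp: line_extension_mem_iff)
qed

lemma coordinates_unique:
  assumes s: "s \<in> carrier L - F" and F: "u \<in> F" "v \<in> F" "u' \<in> F" "v' \<in> F"
    and eq: "u \<otimes> s \<oplus> v = u' \<otimes> s \<oplus> v'"
  shows "u = u'" "v = v'"
proof -
  have c: "u \<in> carrier L" "v \<in> carrier L" "u' \<in> carrier L" "v' \<in> carrier L" "s \<in> carrier L"
    using F s by simp_all
  \<comment> \<open>Subtraction puts \<open>(u \<ominus> u') \<otimes> s\<close> into
    \<open>F\<close>; a nonzero factor from \<open>F\<close> could be cancelled and would force
    \<open>s\<close> into \<open>F\<close>.\<close>
  have "(u \<ominus> u') \<otimes> s = (u \<otimes> s \<oplus> v) \<ominus> (u' \<otimes> s \<oplus> v') \<oplus> (v' \<ominus> v)"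
    using c by algebra
  also have "\<dots> = v' \<ominus> v"
    unfolding eq using c by algebra
  finally have "(u \<ominus> u') \<otimes> s \<in> F" using F by simp
  then have "u \<ominus> u' = \<zero>"
    using F_mult_cancel[of "u \<ominus> u'" s] s F by auto
  then show "u = u'" using c by simp
  then show "v = v'" using eq c by simp
qed

text \<open>Coordinates relative to a basis \<open>s\<close>, \<open>\<one>\<close> identify the
  extension with \<open>F \<times> F\<close>.\<close>

lemma card_carrier:
  assumes fin: "finite F" and nontriv: "carrier L \<noteq> F"
  shows "finite (carrier L)" "card (carrier L) = card F * card F"
proof -
  obtain s where s: "s \<in> carrier L - F" using nontriv F_carrier by blast
  have bij: "bij_betw (\<lambda>(u, v). u \<otimes> s \<oplus> v) (F \<times> F) (carrier L)"
    unfolding bij_betw_def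
  proof
    show "inj_on (\<lambda>(u, v). u \<otimes> s \<oplus> v) (F \<times> F)"
      using coordinates_unique[OF s] by (auto simp: inj_on_def)
    show "(\<lambda>(u, v). u \<otimes> s \<oplus> v) ` (F \<times> F) = carrier L"
    proof
      show "carrier L \<subseteq> (\<lambda>(u, v). u \<otimes> s \<oplus> v) ` (F \<times> F)"
        using coordinates_exist[OF s] by (smt (verit) SigmaI case_prod_conv image_eqI subsetI)
    qed (use s in auto)
  qed
  then show "finite (carrier L)" "card (carrier L) = card F * card F"
    using fin by (auto simp: bij_betw_finite[OF bij, symmetric] bij_betw_same_card[OF bij, symmetric])
qed

text \<open>Completing the square.\<close>

lemma square_root_generator:
  assumes "carrier L \<noteq> F"
  obtains s where "s \<in> carrier L - F" "s \<otimes> s \<in> F"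
proof -
  obtain a where a: "a \<in> carrier L - F" using assms F_carrier by blast
  then obtain t n where tn: "t \<in> F" "n \<in> F" "a \<otimes> a = t \<otimes> a \<oplus> n"
    using coordinates_exist[of a "a \<otimes> a"] by auto
  have c: "a \<in> carrier L" "t \<in> carrier L" "n \<in> carrier L"
    using a tn by simp_all
  \<comment> \<open>With \<open>a \<otimes> a = t \<otimes> a \<oplus> n\<close>, twice
    \<open>a\<close> minus \<open>t\<close> has square \<open>t^2 + 4 n\<close>. Doubling avoids
    halves and keeps \<open>s\<close> outside \<open>F\<close> since two is invertible.\<close>
  define s where "s = (a \<oplus> a) \<ominus> t"
  have "s \<otimes> s = (a \<otimes> a \<oplus> a \<otimes> a \<oplus> a \<otimes> a \<oplus> a \<otimes> a) \<ominus> (t \<otimes> a \<oplus> t \<otimes> a \<oplus> t \<otimes> a \<oplus> t \<otimes> a) \<oplus> t \<otimes> t"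
    unfolding s_def using c by algebra
  also have "\<dots> = n \<oplus> n \<oplus> n \<oplus> n \<oplus> t \<otimes> t"
    unfolding tn(3) using c by algebra
  finally have "s \<otimes> s \<in> F" using tn by simp
  moreover have "s \<notin> F"
  proof
    assume "s \<in> F"
    moreover have "(\<one> \<oplus> \<one>) \<otimes> a = s \<oplus> t"
      unfolding s_def using c by algebra
    ultimately have "(\<one> \<oplus> \<one>) \<otimes> a \<in> F" using tn by simp
    then show False using F_mult_cancel[of "\<one> \<oplus> \<one>" a] two_neq_zero a by auto
  qed
  moreover have "s \<in> carrier L" using c by (simp add: s_def)
  ultimately show thesis using that by blast
qed

lemma double_eq_zero: "x \<in> carrier L \<Longrightarrow> x \<oplus> x = \<zero> \<Longrightarrow> x = \<zero>"
proof -
  assume x: "x \<in> carrier L" "x \<oplus> x = \<zero>"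
  then have "(\<one> \<oplus> \<one>) \<otimes> x = \<zero>" by algebra
  then show "x = \<zero>" using x two_neq_zero integral by blast
qed

lemma square_eq_imp:
  assumes s: "s \<in> carrier L" "t \<in> carrier L" and eq: "t \<otimes> t = s \<otimes> s"
  shows "t = s \<or> t = \<ominus> s"
proof -
  have "(t \<ominus> s) \<otimes> (t \<oplus> s) = t \<otimes> t \<ominus> s \<otimes> s"
    using s by algebra
  also have "\<dots> = \<zero>"
    using s by (simp add: eq)
  finally have "t \<ominus> s = \<zero> \<or> t \<oplus> s = \<zero>"
    using s by (intro integral) simp_all
  then show ?thesis
    using s by (auto intro: minus_equality[symmetric])
qed

text \<open>The witness is the conjugation sending \<open>u s + v\<close> to
  \<open>- u s + v\<close>, where \<open>s \<otimes> s\<close> lies in \<open>F\<close>. Its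
  existence rules out that a generator of the Galois group is the identity.\<close>

lemma nontrivial_automorphism:
  assumes nontriv: "carrier L \<noteq> F"
  obtains \<tau> where "\<tau> \<in> carrier (galois_group L F)" "\<tau> \<noteq> (\<lambda>x\<in>carrier L. x)"
proof -
  obtain s where s: "s \<in> carrier L - F" and ss: "s \<otimes> s \<in> F"
    using square_root_generator[OF nontriv] .
  have sc: "s \<in> carrier L" using s by simp
  \<comment> \<open>Uniqueness of coordinates makes the description definite; the restriction to the
    carrier makes \<open>\<tau>\<close> extensional, as \<open>Bij\<close> requires.\<close>
  define \<tau> where "\<tau> = (\<lambda>x\<in>carrier L. THE y. \<exists>u\<in>F. \<exists>v\<in>F. x = u \<otimes> s \<oplus> v \<and> y = (\<ominus> u) \<otimes> s \<oplus> v)"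
  have \<tau>: "\<tau> (u \<otimes> s \<oplus> v) = (\<ominus> u) \<otimes> s \<oplus> v" if "u \<in> F" "v \<in> F" for u v
  proof -
    have "(THE y. \<exists>u'\<in>F. \<exists>v'\<in>F. u \<otimes> s \<oplus> v = u' \<otimes> s \<oplus> v' \<and> y = (\<ominus> u') \<otimes> s \<oplus> v') = (\<ominus> u) \<otimes> s \<oplus> v"
    proof (rule the_equality)
      fix y assume "\<exists>u'\<in>F. \<exists>v'\<in>F. u \<otimes> s \<oplus> v = u' \<otimes> s \<oplus> v' \<and> y = (\<ominus> u') \<otimes> s \<oplus> v'"
      then obtain u' v' where "u' \<in> F" "v' \<in> F" "u \<otimes> s \<oplus> v = u' \<otimes> s \<oplus> v'"
        "y = (\<ominus> u') \<otimes> s \<oplus> v'" by blast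
      then show "y = (\<ominus> u) \<otimes> s \<oplus> v"
        using coordinates_unique[OF s that, of u' v'] by simp
    qed (use that in blast)
    then show ?thesis
      using that sc by (simp add: \<tau>_def)
  qed
  have coords: "\<exists>u\<in>F. \<exists>v\<in>F. x = u \<otimes> s \<oplus> v" if "x \<in> carrier L" for x
    using coordinates_exist[OF s that] by blast
  have closed: "\<tau> x \<in> carrier L" if "x \<in> carrier L" for x
    using coords[OF that] \<tau> sc by auto
  have invol: "\<tau> (\<tau> x) = x" if "x \<in> carrier L" for x
    using coords[OF that] \<tau> sc by auto
  have fixes_F: "\<tau> c = c" if "c \<in> F" for c
    using \<tau>[of \<zero> c] that sc by simp
  have "\<tau> \<in> ring_hom L L"
  proof (rule ring_hom_memI)
    fix x y assume "x \<in> carrier L" "y \<in> carrier L"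
    then obtain u v u' v' where uv: "u \<in> F" "v \<in> F" "u' \<in> F" "v' \<in> F"
      and x: "x = u \<otimes> s \<oplus> v" and y: "y = u' \<otimes> s \<oplus> v'"
      using coords by metis
    then have c: "u \<in> carrier L" "v \<in> carrier L" "u' \<in> carrier L" "v' \<in> carrier L"
      by simp_all
    have "x \<oplus> y = (u \<oplus> u') \<otimes> s \<oplus> (v \<oplus> v')"
      unfolding x y using c sc by algebra
    then have "\<tau> (x \<oplus> y) = (\<ominus> (u \<oplus> u')) \<otimes> s \<oplus> (v \<oplus> v')"
      using \<tau> uv by simp
    also have "\<dots> = ((\<ominus> u) \<otimes> s \<oplus> v) \<oplus> ((\<ominus> u') \<otimes> s \<oplus> v')"
      using c sc by algebra
    also have "\<dots> = \<tau> x \<oplus> \<tau> y"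
      unfolding x y using \<tau> uv by simp
    finally show "\<tau> (x \<oplus> y) = \<tau> x \<oplus> \<tau> y" .
    \<comment> \<open>As \<open>s \<otimes> s\<close> lies in \<open>F\<close>, it belongs to the
      second coordinate, and replacing \<open>s\<close> by \<open>\<ominus> s\<close> leaves it
      unchanged.\<close>
    have "x \<otimes> y = (u \<otimes> v' \<oplus> v \<otimes> u') \<otimes> s \<oplus> (u \<otimes> u' \<otimes> (s \<otimes> s) \<oplus> v \<otimes> v')"
      unfolding x y using c sc by algebra
    then have "\<tau> (x \<otimes> y) = (\<ominus> (u \<otimes> v' \<oplus> v \<otimes> u')) \<otimes> s \<oplus> (u \<otimes> u' \<otimes> (s \<otimes> s) \<oplus> v \<otimes> v')"
      using \<tau> uv ss by simp
    also have "\<dots> = ((\<ominus> u) \<otimes> s \<oplus> v) \<otimes> ((\<ominus> u') \<otimes> s \<oplus> v')"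
      using c sc by algebra
    also have "\<dots> = \<tau> x \<otimes> \<tau> y"
      unfolding x y using \<tau> uv by simp
    finally show "\<tau> (x \<otimes> y) = \<tau> x \<otimes> \<tau> y" .
  qed (use closed fixes_F in auto)
  moreover have "\<tau> \<in> Bij (carrier L)"
  proof -
    have "bij_betw \<tau> (carrier L) (carrier L)"
      by (rule bij_betw_byWitness[where f' = \<tau>]) (use closed invol in auto)
    moreover have "\<tau> \<in> extensional (carrier L)"
      by (simp add: \<tau>_def)
    ultimately show ?thesis by (simp add: Bij_def)
  qed
  moreover have "\<tau> \<noteq> (\<lambda>x\<in>carrier L. x)"
  proof
    assume "\<tau> = (\<lambda>x\<in>carrier L. x)"
    then have "s = \<ominus> s"
      using \<tau>[of \<one> \<zero>] sc by (simp add: l_minus)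
    then have "s \<oplus> s = \<zero>" using sc by (metis r_neg)
    then show False using double_eq_zero[of s] s by simp
  qed
  ultimately show thesis
    using fixes_F by (intro that) (simp_all add: galois_group_def)
qed

end

section \<open>The action of a generator of the Galois group\<close>

locale quadratic_galois_extension = quadratic_extension +
  fixes \<sigma>
  assumes sigma_in: "\<sigma> \<in> carrier (galois_group L F)"
    and sigma_gen: "generate (galois_group L F) {\<sigma>} = carrier (galois_group L F)"
    and nontrivial: "carrier L \<noteq> F"
begin

lemma sigma_hom: "\<sigma> \<in> ring_hom L L" and sigma_Bij: "\<sigma> \<in> Bij (carrier L)"
  and sigma_F [simp]: "c \<in> F \<Longrightarrow> \<sigma> c = c"
  using sigma_in by (auto simp: galois_group_def)

sublocale sigma: ring_hom_cring L L \<sigma>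
  by unfold_locales (rule sigma_hom)

text \<open>The identity generates only the trivial subgroup, whereas conjugation is a nontrivial
  element of the Galois group.\<close>

lemma sigma_neq_id: "\<sigma> \<noteq> (\<lambda>x\<in>carrier L. x)"
proof
  assume "\<sigma> = (\<lambda>x\<in>carrier L. x)"
  then have "\<sigma> = \<one>\<^bsub>galois_group L F\<^esub>"
    by (simp add: galois_group_def BijGroup_def)
  then have "carrier (galois_group L F) = {\<one>\<^bsub>galois_group L F\<^esub>}"
    using sigma_gen group.generate_one[OF galois_group_is_group[OF ring_axioms]] F_carrier
    by (metis subsetI)
  moreover obtain \<tau> where "\<tau> \<in> carrier (galois_group L F)" "\<tau> \<noteq> (\<lambda>x\<in>carrier L. x)"
    using nontrivial_automorphism[OF nontrivial] .
  ultimately show False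
    by (simp add: galois_group_def BijGroup_def)
qed

text \<open>A square root \<open>s\<close> of an element of \<open>F\<close> is sent by
  \<open>\<sigma>\<close> to \<open>s\<close> or \<open>\<ominus> s\<close>; fixing \<open>s\<close>
  would, by coordinates, make \<open>\<sigma>\<close> the identity.\<close>

lemma sigma_square_root:
  obtains s where "s \<in> carrier L - F" "\<sigma> s = \<ominus> s"
proof -
  obtain s where s: "s \<in> carrier L - F" and ss: "s \<otimes> s \<in> F"
    using square_root_generator[OF nontrivial] .
  have sc: "s \<in> carrier L" "\<sigma> s \<in> carrier L" using s by simp_all
  have "\<sigma> (s \<otimes> s) = s \<otimes> s"
    using ss by (rule sigma_F)
  then have "\<sigma> s \<otimes> \<sigma> s = s \<otimes> s"
    using sc by simp
  then consider "\<sigma> s = s" | "\<sigma> s = \<ominus> s"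
    using square_eq_imp[OF sc] by blast
  then show thesis
  proof cases
    case 1
    then have \<sigma>s: "\<sigma> s = s" .
    have "\<sigma> x = x" if x: "x \<in> carrier L" for x
    proof -
      obtain u v where "u \<in> F" "v \<in> F" "x = u \<otimes> s \<oplus> v"
        using coordinates_exist[OF s x] .
      then show ?thesis using \<sigma>s sc by simp
    qed
    then have "\<sigma> = (\<lambda>x\<in>carrier L. x)"
      using sigma_Bij by (auto simp: Bij_def extensional_def)
    then show ?thesis using sigma_neq_id by blast
  next
    case 2
    then show ?thesis by (rule that[OF s])
  qed
qed

lemma sigma_sigma [simp]: "x \<in> carrier L \<Longrightarrow> \<sigma> (\<sigma> x) = x"
proof -
  assume x: "x \<in> carrier L"
  obtain s where s: "s \<in> carrier L - F" "\<sigma> s = \<ominus> s" using sigma_square_root .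
  obtain u v where "u \<in> F" "v \<in> F" "x = u \<otimes> s \<oplus> v"
    using coordinates_exist[OF s(1) x] .
  then show ?thesis using s by simp
qed

text \<open>Since \<open>\<sigma>\<close> negates the coordinate at \<open>s\<close>, a fixed
  element has \<open>\<ominus> u = u\<close>, hence \<open>u = \<zero>\<close> in characteristic not
  two.\<close>

lemma sigma_fixed: "x \<in> carrier L \<Longrightarrow> \<sigma> x = x \<Longrightarrow> x \<in> F"
proof -
  assume x: "x \<in> carrier L" "\<sigma> x = x"
  obtain s where s: "s \<in> carrier L - F" "\<sigma> s = \<ominus> s" using sigma_square_root .
  obtain u v where uv: "u \<in> F" "v \<in> F" "x = u \<otimes> s \<oplus> v"
    using coordinates_exist[OF s(1) x(1)] .
  have "(\<ominus> u) \<otimes> s \<oplus> v = u \<otimes> s \<oplus> v"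
    using x(2) uv s by (simp add: l_minus r_minus)
  then have "\<ominus> u = u"
    using coordinates_unique[OF s(1)] uv by simp
  then have "u = \<zero>" using double_eq_zero[of u] uv by (metis F_carrier r_neg)
  then show "x \<in> F" using uv s by simp
qed

lemma sigma_eq_zero: "x \<in> carrier L \<Longrightarrow> \<sigma> x = \<zero> \<longleftrightarrow> x = \<zero>"
  by (metis sigma.hom_zero sigma_sigma)

text \<open>By coordinates, an endomorphism over \<open>F\<close> is determined by the image of
  \<open>s\<close>, which must be a square root of \<open>s \<otimes> s\<close>, that is
  \<open>s\<close> or \<open>\<ominus> s = \<sigma> s\<close>.\<close>

lemma automorphism_cases:
  assumes \<tau>: "\<tau> \<in> ring_hom L L" and \<tau>_F: "\<And>c. c \<in> F \<Longrightarrow> \<tau> c = c"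
  shows "(\<forall>x\<in>carrier L. \<tau> x = x) \<or> (\<forall>x\<in>carrier L. \<tau> x = \<sigma> x)"
proof -
  interpret t: ring_hom_cring L L \<tau>
    by unfold_locales (rule \<tau>)
  obtain s where s: "s \<in> carrier L - F" "\<sigma> s = \<ominus> s" using sigma_square_root .
  have sc: "s \<in> carrier L" "\<tau> s \<in> carrier L" using s by simp_all
  have "\<sigma> (s \<otimes> s) = s \<otimes> s"
    using sc s(2) by (simp add: l_minus r_minus)
  then have "s \<otimes> s \<in> F" by (rule sigma_fixed[OF m_closed[OF sc(1) sc(1)]])
  then have "\<tau> (s \<otimes> s) = s \<otimes> s" by (rule \<tau>_F)
  then have "\<tau> s \<otimes> \<tau> s = s \<otimes> s"
    using sc by simp
  then have "\<tau> s = s \<or> \<tau> s = \<sigma> s"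
    using square_eq_imp[OF sc] s(2) by simp
  moreover have "\<tau> x = f x"
    if x: "x \<in> carrier L" and f: "f \<in> ring_hom L L" "\<And>c. c \<in> F \<Longrightarrow> f c = c" "\<tau> s = f s" for x f
  proof -
    obtain u v where uv: "u \<in> F" "v \<in> F" "x = u \<otimes> s \<oplus> v"
      using coordinates_exist[OF s(1) x] .
    then show ?thesis
      using f sc by (simp add: \<tau>_F ring_hom_add[OF f(1)] ring_hom_mult[OF f(1)])
  qed
  moreover have "(\<lambda>x. x) \<in> ring_hom L L" by (auto intro!: ring_hom_memI)
  ultimately show ?thesis
    using sigma_hom sigma_F by (metis (no_types, lifting))
qed

end

\<comment> \<open>The unqualified name is taken by \<^theory>\<open>HOL-Algebra.Ring_Divisibility\<close>.\<close>
abbreviation "mult_group \<equiv> Multiplicative_Group.mult_of"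

text \<open>The first isomorphism theorem combined with Lagrange's theorem for the kernel.\<close>

lemma (in group_hom) order_times_card_kernel:
  assumes "h ` carrier G = carrier H"
  shows "order H * card (kernel G H h) = order G"
proof -
  have "order H = card (carrier (G Mod kernel G H h))"
    unfolding order_def using iso_same_card[OF FactGroup_iso[OF assms]] by simp
  then show ?thesis
    using G.lagrange[OF subgroup_kernel] by (simp add: FactGroup_def)
qed

text \<open>The known generator enumerates the group by natural powers taken in the field; the
  criterion for \<open>cyclic_group\<close> asks for integer powers in the multiplicative
  group.\<close>

lemma (in field) cyclic_mult_of:
  assumes "finite (carrier R)"
  shows "cyclic_group (mult_group R)"
proof -
  interpret M: group "mult_group R" by (rule field_mult_group)
  obtain g where g: "g \<in> carrier (mult_group R)" "carrier (mult_group R) = {g [^] i | i::nat. i \<in> UNIV}"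
    using finite_field_mult_group_has_gen[OF assms] by blast
  have "carrier (mult_group R) = range (\<lambda>n::int. g [^]\<^bsub>mult_group R\<^esub> n)"
  proof
    show "carrier (mult_group R) \<subseteq> range (\<lambda>n::int. g [^]\<^bsub>mult_group R\<^esub> n)"
    proof
      fix x assume "x \<in> carrier (mult_group R)"
      then obtain i :: nat where "x = g [^]\<^bsub>mult_group R\<^esub> i"
        unfolding g(2) by (auto simp: Multiplicative_Group.nat_pow_mult_of)
      then have "x = g [^]\<^bsub>mult_group R\<^esub> int i" by (simp only: int_pow_int)
      then show "x \<in> range (\<lambda>n::int. g [^]\<^bsub>mult_group R\<^esub> n)" by (rule range_eqI)
    qed
    show "range (\<lambda>n::int. g [^]\<^bsub>mult_group R\<^esub> n) \<subseteq> carrier (mult_group R)"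
      using M.int_pow_closed[OF g(1)] by blast
  qed
  then show ?thesis using g(1) M.cyclic_group by blast
qed

section \<open>Elements of norm one\<close>

context quadratic_galois_extension
begin

text \<open>The kernel of the norm map from \<open>L\<close> to \<open>F\<close>; on it,
  \<open>\<sigma>\<close> is inversion.\<close>

definition norm_one :: "'a set" where
  "norm_one = {u \<in> carrier L. u \<otimes> \<sigma> u = \<one>}"

definition norm_one_group :: "'a monoid" where
  "norm_one_group = (mult_group L)\<lparr>carrier := norm_one\<rparr>"

lemma norm_one_carrier: "u \<in> norm_one \<Longrightarrow> u \<in> carrier L"
  by (simp add: norm_one_def)

lemma norm_one_group_simps [simp]:
  "carrier norm_one_group = norm_one" "\<one>\<^bsub>norm_one_group\<^esub> = \<one>"
  "u \<otimes>\<^bsub>norm_one_group\<^esub> v = u \<otimes> v"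
  by (simp_all add: norm_one_group_def)

lemma norm_mult:
  assumes "x \<in> carrier L" "y \<in> carrier L"
  shows "(x \<otimes> y) \<otimes> \<sigma> (x \<otimes> y) = (x \<otimes> \<sigma> x) \<otimes> (y \<otimes> \<sigma> y)"
proof -
  have "(x \<otimes> y) \<otimes> (\<sigma> x \<otimes> \<sigma> y) = (x \<otimes> \<sigma> x) \<otimes> (y \<otimes> \<sigma> y)"
    using assms sigma.hom_closed[of x] sigma.hom_closed[of y] by algebra
  then show ?thesis using assms by (simp only: sigma.hom_mult)
qed

lemma norm_one_mult: "\<lbrakk>u \<in> norm_one; v \<in> norm_one\<rbrakk> \<Longrightarrow> u \<otimes> v \<in> norm_one"
  unfolding norm_one_def by (simp only: mem_Collect_eq norm_mult m_closed l_one one_closed)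

lemma norm_one_sigma: "u \<in> norm_one \<Longrightarrow> \<sigma> u \<in> norm_one"
  unfolding norm_one_def by (simp only: mem_Collect_eq sigma_sigma m_comm sigma.hom_closed)

lemma group_norm_one: "group norm_one_group"
proof (rule groupI)
  fix u assume u: "u \<in> carrier norm_one_group"
  then have "\<sigma> u \<otimes> u = \<one>"
    by (simp only: norm_one_group_simps norm_one_def mem_Collect_eq sigma.hom_closed m_comm[of "\<sigma> u" u])
  then show "\<exists>v\<in>carrier norm_one_group. v \<otimes>\<^bsub>norm_one_group\<^esub> u = \<one>\<^bsub>norm_one_group\<^esub>"
    using norm_one_sigma u by (intro bexI[of _ "\<sigma> u"]) simp_all
next
  show "\<one>\<^bsub>norm_one_group\<^esub> \<in> carrier norm_one_group"
    by (simp add: norm_one_def)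
qed (simp_all add: norm_one_mult norm_one_carrier m_assoc)

lemma sigma_inv:
  assumes "x \<in> carrier L" "x \<noteq> \<zero>"
  shows "\<sigma> (inv x) = inv (\<sigma> x)"
proof -
  have x: "x \<in> Units L" using assms by (simp add: field_Units)
  then have "\<sigma> (x \<otimes> inv x) = \<one>"
    by (simp only: Units_r_inv sigma.hom_one)
  then have "\<sigma> x \<otimes> \<sigma> (inv x) = \<one>"
    using x by (simp only: sigma.hom_mult Units_closed Units_inv_closed)
  then show ?thesis
    using x by (intro comm_inv_char[symmetric]) (simp_all only: sigma.hom_closed Units_closed Units_inv_closed)
qed

text \<open>Hilbert 90 identifies the elements of norm one as the quotients \<open>v / \<sigma>(v)\<close>.\<close>

lemma quotient_epi:
  "(\<lambda>v. v \<otimes> inv (\<sigma> v)) \<in> epi (mult_group L) norm_one_group"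
  "kernel (mult_group L) norm_one_group (\<lambda>v. v \<otimes> inv (\<sigma> v)) = F - {\<zero>}"
proof -
  let ?h = "\<lambda>v. v \<otimes> inv (\<sigma> v)"
  have U: "v \<in> Units L" "\<sigma> v \<in> Units L" if "v \<in> carrier (mult_group L)" for v
    using that by (simp_all add: field_Units sigma_eq_zero)
  \<comment> \<open>Clearing the denominator gives a form without inverses, from which
    multiplicativity, surjectivity and the kernel are all read off.\<close>
  have h_eq_iff: "?h v = u \<longleftrightarrow> v = u \<otimes> \<sigma> v" if "v \<in> carrier (mult_group L)" "u \<in> carrier L" for u v
  proof
    have c: "v \<in> carrier L" "\<sigma> v \<in> carrier L" "inv (\<sigma> v) \<in> carrier L"
      using U[OF that(1)] that by simp_all
    show "v = u \<otimes> \<sigma> v" if "?h v = u"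
      using U(2)[OF \<open>v \<in> carrier (mult_group L)\<close>] c by (simp add: m_assoc flip: that)
    show "?h v = u" if "v = u \<otimes> \<sigma> v"
    proof -
      have "?h v = u \<otimes> \<sigma> v \<otimes> inv (\<sigma> v)" using that by simp
      also have "\<dots> = u"
        using U(2)[OF \<open>v \<in> carrier (mult_group L)\<close>] c \<open>u \<in> carrier L\<close> by (simp add: m_assoc)
      finally show ?thesis .
    qed
  qed
  have "?h v \<in> norm_one" if v: "v \<in> carrier (mult_group L)" for v
  proof -
    have c: "v \<in> carrier L" "\<sigma> v \<in> carrier L" "inv v \<in> carrier L" "inv (\<sigma> v) \<in> carrier L"
      using U[OF v] v by simp_all
    have "\<sigma> (inv (\<sigma> v)) = inv v"
      using U[OF v] c v by (subst sigma_inv) (simp_all add: sigma_eq_zero)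
    then have "?h v \<otimes> \<sigma> (?h v) = (v \<otimes> inv (\<sigma> v)) \<otimes> (\<sigma> v \<otimes> inv v)"
      using c by simp
    also have "\<dots> = (v \<otimes> inv v) \<otimes> (inv (\<sigma> v) \<otimes> \<sigma> v)"
      using c by algebra
    finally have "?h v \<otimes> \<sigma> (?h v) = (v \<otimes> inv v) \<otimes> (inv (\<sigma> v) \<otimes> \<sigma> v)" .
    then show ?thesis
      using U[OF v] c by (simp add: norm_one_def)
  qed
  then have closed: "?h \<in> carrier (mult_group L) \<rightarrow> norm_one" by blast
  have "?h \<in> hom (mult_group L) norm_one_group"
  proof (rule homI)
    fix x y assume x: "x \<in> carrier (mult_group L)" and y: "y \<in> carrier (mult_group L)"
    have h: "?h x \<in> carrier L" "?h y \<in> carrier L"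
      using closed x y norm_one_carrier by blast+
    have c: "x \<in> carrier L" "y \<in> carrier L" "\<sigma> x \<in> carrier L" "\<sigma> y \<in> carrier L"
      using x y by simp_all
    have xy: "x \<otimes> y \<in> carrier (mult_group L)"
      using x y integral by auto
    have "x \<otimes> y = (?h x \<otimes> \<sigma> x) \<otimes> (?h y \<otimes> \<sigma> y)"
      using h_eq_iff[OF x h(1)] h_eq_iff[OF y h(2)] by simp
    also have "\<dots> = (?h x \<otimes> ?h y) \<otimes> \<sigma> (x \<otimes> y)"
      using h c by (simp only: sigma.hom_mult m_ac m_closed)
    finally show "?h (x \<otimes>\<^bsub>mult_group L\<^esub> y) = ?h x \<otimes>\<^bsub>norm_one_group\<^esub> ?h y"
      using h_eq_iff[OF xy m_closed[OF h]] by simp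
  qed (use closed in auto)
  moreover have "norm_one \<subseteq> ?h ` carrier (mult_group L)"
  proof
    fix u assume u: "u \<in> norm_one"
    then have uc: "u \<in> carrier L" "u \<otimes> \<sigma> u = \<one>" by (simp_all add: norm_one_def)
    \<comment> \<open>In general \<open>\<one> \<oplus> u\<close> works, since
      \<open>u \<otimes> \<sigma> (\<one> \<oplus> u) = u \<oplus> \<one>\<close>. It vanishes for
      \<open>u = \<ominus> \<one>\<close>, where an element negated by \<open>\<sigma>\<close>
      serves instead.\<close>
    obtain v where v: "v \<in> carrier (mult_group L)" "v = u \<otimes> \<sigma> v"
    proof (cases "\<one> \<oplus> u = \<zero>")
      case True
      obtain s where s: "s \<in> carrier L - F" "\<sigma> s = \<ominus> s" using sigma_square_root .
      have "u = \<ominus> \<one>" using True uc by (metis minus_equality one_closed a_comm)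
      then have "s = u \<otimes> \<sigma> s" using s by (simp add: l_minus r_minus)
      moreover have "s \<noteq> \<zero>" using s F_closed(1) by auto
      ultimately show thesis using that[of s] s by auto
    next
      case False
      then show thesis using that[of "\<one> \<oplus> u"] uc by (simp add: r_distr a_comm)
    qed
    have "?h v = u" using h_eq_iff[OF v(1) uc(1)] v(2) by blast
    then show "u \<in> ?h ` carrier (mult_group L)" using v(1) by blast
  qed
  moreover have "?h ` carrier (mult_group L) \<subseteq> norm_one" using closed by blast
  ultimately show "?h \<in> epi (mult_group L) norm_one_group"
    unfolding epi_def norm_one_group_simps by blast
  show "kernel (mult_group L) norm_one_group ?h = F - {\<zero>}"
  proof (rule Set.set_eqI)
    fix v
    have "v \<in> carrier (mult_group L) \<and> ?h v = \<one> \<longleftrightarrow> v \<in> carrier (mult_group L) \<and> v = \<sigma> v"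
      using h_eq_iff[of v \<one>] by (metis Diff_iff Multiplicative_Group.carrier_mult_of l_one one_closed sigma.hom_closed)
    also have "\<dots> \<longleftrightarrow> v \<in> F - {\<zero>}"
      by (metis Diff_iff F_carrier Multiplicative_Group.carrier_mult_of sigma_F sigma_fixed)
    finally show "v \<in> kernel (mult_group L) norm_one_group ?h \<longleftrightarrow> v \<in> F - {\<zero>}"
      unfolding kernel_def by simp
  qed
qed

text \<open>For \<open>q = card F\<close>, the map \<open>v / \<sigma>(v)\<close> leaves a cyclic
  group of order \<open>q^2 - 1\<close> and has a kernel of order \<open>q - 1\<close>, so its image
  is cyclic of order \<open>q + 1\<close>.\<close>

lemma norm_one_structure:
  assumes fin: "finite F"
  shows "finite norm_one" "card norm_one = card F + 1" "cyclic_group norm_one_group"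
proof -
  interpret M: group "mult_group L" by (rule field_mult_group)
  interpret N: group norm_one_group by (rule group_norm_one)
  interpret h: group_hom "mult_group L" norm_one_group "\<lambda>v. v \<otimes> inv (\<sigma> v)"
    by unfold_locales (use quotient_epi(1) in \<open>simp only: epi_def mem_Collect_eq\<close>)
  note finL = card_carrier[OF fin nontrivial]
  show "finite norm_one" by (rule finite_subset[OF _ finL(1)]) (blast dest: norm_one_carrier)
  have "order norm_one_group * card (F - {\<zero>}) = order (mult_group L)"
    using h.order_times_card_kernel quotient_epi unfolding epi_def by auto
  then have "card norm_one * (card F - 1) = card F * card F - 1"
    using fin finL by (simp add: order_def card_Diff_singleton)
  also have "\<dots> = (card F + 1) * (card F - 1)"
    by (simp add: algebra_simps diff_mult_distrib2)
  finally have "card norm_one * (card F - 1) = (card F + 1) * (card F - 1)" .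
  \<comment> \<open>The factor \<open>card F - 1\<close> may be cancelled because \<open>F\<close>
    has at least two elements.\<close>
  moreover have "card {\<zero>, \<one>} \<le> card F"
    by (rule card_mono[OF fin]) simp
  then have "card F - 1 \<noteq> 0" by simp
  ultimately show "card norm_one = card F + 1" by (simp only: mult_cancel2) simp
  show "cyclic_group norm_one_group"
    using M.cyclic_group_epimorphic_image quotient_epi(1) cyclic_mult_of[OF finL(1)] group_norm_one
    by blast
qed

end

section \<open>Automorphisms of the nonassociative cyclic algebra\<close>

locale quadratic_cyclic_algebra = quadratic_galois_extension +
  fixes a
  assumes finite_F: "finite F" and a: "a \<in> carrier L - F"
begin

declare F_carrier [simp del] F_closed [simp del]

abbreviation A :: "('a, 'a \<times> 'a) module" where
  "A \<equiv> nonassoc_cyclic_algebra L \<sigma> a"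

abbreviation Aut :: "('a \<times> 'a \<Rightarrow> 'a \<times> 'a) monoid" where
  "Aut \<equiv> algebra_Aut (L\<lparr>carrier := F\<rparr>) A"

lemma a_simps [simp]: "a \<in> carrier L" "a \<noteq> \<zero>" "\<sigma> a \<noteq> a" "a \<noteq> \<sigma> a"
  using a sigma_fixed[of a] F_closed(1) by auto

lemma A_simps [simp]:
  "carrier A = carrier L \<times> carrier L"
  "(x0, x1) \<otimes>\<^bsub>A\<^esub> (y0, y1) = ((x0 \<otimes> y0) \<oplus> (x1 \<otimes> \<sigma> y1 \<otimes> a), (x0 \<otimes> y1) \<oplus> (x1 \<otimes> \<sigma> y0))"
  "\<one>\<^bsub>A\<^esub> = (\<one>, \<zero>)"
  "(x0, x1) \<oplus>\<^bsub>A\<^esub> (y0, y1) = (x0 \<oplus> y0, x1 \<oplus> y1)"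
  "c \<odot>\<^bsub>A\<^esub> (x0, x1) = (c \<otimes> x0, c \<otimes> x1)"
  by (simp_all add: nonassoc_cyclic_algebra_def)

lemma group_Aut: "group Aut"
proof -
  have smult: "c \<odot>\<^bsub>A\<^esub> x \<in> carrier A" if "c \<in> F" "x \<in> carrier A" for c x
    using that F_carrier by (cases x) simp
  have "subgroup {f \<in> ring_hom A A \<inter> Bij (carrier A).
      \<forall>c\<in>F. \<forall>x\<in>carrier A. f (c \<odot>\<^bsub>A\<^esub> x) = c \<odot>\<^bsub>A\<^esub> f x} (BijGroup (carrier A))"
  proof (rule subgroup_ring_automorphisms)
    fix f g
    assume g: "g \<in> Bij (carrier A)"
      and f_lin: "\<forall>c\<in>F. \<forall>x\<in>carrier A. f (c \<odot>\<^bsub>A\<^esub> x) = c \<odot>\<^bsub>A\<^esub> f x"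
      and g_lin: "\<forall>c\<in>F. \<forall>x\<in>carrier A. g (c \<odot>\<^bsub>A\<^esub> x) = c \<odot>\<^bsub>A\<^esub> g x"
    show "\<forall>c\<in>F. \<forall>x\<in>carrier A.
        compose (carrier A) f g (c \<odot>\<^bsub>A\<^esub> x) = c \<odot>\<^bsub>A\<^esub> compose (carrier A) f g x"
    proof (intro ballI)
      fix c x assume c: "c \<in> F" and x: "x \<in> carrier A"
      have "g x \<in> carrier A"
        using Bij_imp_funcset[OF g] x by blast
      then show "compose (carrier A) f g (c \<odot>\<^bsub>A\<^esub> x) = c \<odot>\<^bsub>A\<^esub> compose (carrier A) f g x"
        using f_lin g_lin c x smult by (simp only: compose_eq)
    qed
  next
    fix f
    assume f: "f \<in> Bij (carrier A)" and lin: "\<forall>c\<in>F. \<forall>x\<in>carrier A. f (c \<odot>\<^bsub>A\<^esub> x) = c \<odot>\<^bsub>A\<^esub> f x"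
    have "inv_into (carrier A) f (c \<odot>\<^bsub>A\<^esub> x) = c \<odot>\<^bsub>A\<^esub> inv_into (carrier A) f x"
      if c: "c \<in> F" and x: "x \<in> carrier A" for c x
    proof -
      have bij: "bij_betw f (carrier A) (carrier A)" using f by (simp add: Bij_def)
      let ?y = "inv_into (carrier A) f x"
      have y: "?y \<in> carrier A" "f ?y = x"
        using bij x by (simp_all only: Bij_inv_into_mem[OF f] bij_betw_inv_into_right)
      then have "f (c \<odot>\<^bsub>A\<^esub> ?y) = c \<odot>\<^bsub>A\<^esub> x"
        using lin c by metis
      then show ?thesis
        using bij_betw_inv_into_left[OF bij smult[OF c y(1)]] by simp
    qed
    then show "\<forall>c\<in>F. \<forall>x\<in>carrier A. restrict (inv_into (carrier A) f) (carrier A) (c \<odot>\<^bsub>A\<^esub> x)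
        = c \<odot>\<^bsub>A\<^esub> restrict (inv_into (carrier A) f) (carrier A) x"
      using smult by (intro ballI) (simp only: restrict_apply if_True)
  qed (auto simp: F_carrier)
  then show ?thesis
    unfolding algebra_Aut_def
    using subgroup.subgroup_is_group[OF _ group_BijGroup] by (simp del: A_simps)
qed

text \<open>The candidate automorphism that acts as \<open>\<tau>\<close> on \<open>L\<close> and
  sends \<open>z\<close> to \<open>l z\<close>.\<close>

definition twist :: "('a \<Rightarrow> 'a) \<Rightarrow> 'a \<Rightarrow> 'a \<times> 'a \<Rightarrow> 'a \<times> 'a" where
  "twist \<tau> l = (\<lambda>x\<in>carrier A. (\<tau> (fst x), \<tau> (snd x) \<otimes> l))"

lemma twist_apply: "\<lbrakk>x0 \<in> carrier L; x1 \<in> carrier L\<rbrakk> \<Longrightarrow> twist \<tau> l (x0, x1) = (\<tau> x0, \<tau> x1 \<otimes> l)"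
  by (simp add: twist_def)

text \<open>
  The left nucleus of \<^term>\<open>A\<close> is \<open>L\<close>, because \<open>(z z) z = a z\<close> while \<open>z (z z) = \<sigma>(a) z\<close>.
\<close>

lemma left_nucleus_iff:
  assumes u: "u \<in> carrier A"
  shows "(\<forall>v\<in>carrier A. \<forall>w\<in>carrier A. (u \<otimes>\<^bsub>A\<^esub> v) \<otimes>\<^bsub>A\<^esub> w = u \<otimes>\<^bsub>A\<^esub> (v \<otimes>\<^bsub>A\<^esub> w)) \<longleftrightarrow> snd u = \<zero>"
proof -
  obtain x0 x1 where ux: "u = (x0, x1)" and x: "x0 \<in> carrier L" "x1 \<in> carrier L"
    using u by auto
  show ?thesis
  proof
    assume "\<forall>v\<in>carrier A. \<forall>w\<in>carrier A. (u \<otimes>\<^bsub>A\<^esub> v) \<otimes>\<^bsub>A\<^esub> w = u \<otimes>\<^bsub>A\<^esub> (v \<otimes>\<^bsub>A\<^esub> w)"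
    then have "(u \<otimes>\<^bsub>A\<^esub> (\<zero>, \<one>)) \<otimes>\<^bsub>A\<^esub> (\<zero>, \<one>) = u \<otimes>\<^bsub>A\<^esub> ((\<zero>, \<one>) \<otimes>\<^bsub>A\<^esub> (\<zero>, \<one>))"
      by simp
    then have "x1 \<otimes> a = x1 \<otimes> \<sigma> a"
      using x by (simp add: ux)
    then show "snd u = \<zero>"
      using x m_lcancel[of x1 a "\<sigma> a"] by (auto simp: ux)
  next
    assume "snd u = \<zero>"
    then have x1: "x1 = \<zero>" by (simp add: ux)
    show "\<forall>v\<in>carrier A. \<forall>w\<in>carrier A. (u \<otimes>\<^bsub>A\<^esub> v) \<otimes>\<^bsub>A\<^esub> w = u \<otimes>\<^bsub>A\<^esub> (v \<otimes>\<^bsub>A\<^esub> w)"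
    proof (intro ballI)
      fix v w assume "v \<in> carrier A" "w \<in> carrier A"
      then obtain y0 y1 w0 w1 where "v = (y0, y1)" "w = (w0, w1)"
        and "y0 \<in> carrier L" "y1 \<in> carrier L" "w0 \<in> carrier L" "w1 \<in> carrier L"
        by auto
      then show "(u \<otimes>\<^bsub>A\<^esub> v) \<otimes>\<^bsub>A\<^esub> w = u \<otimes>\<^bsub>A\<^esub> (v \<otimes>\<^bsub>A\<^esub> w)"
        using x by (simp add: ux x1 m_assoc r_distr)
    qed
  qed
qed

lemma AutD:
  assumes "f \<in> carrier Aut"
  shows "f \<in> ring_hom A A" "f \<in> Bij (carrier A)"
    "\<And>c x. \<lbrakk>c \<in> F; x \<in> carrier A\<rbrakk> \<Longrightarrow> f (c \<odot>\<^bsub>A\<^esub> x) = c \<odot>\<^bsub>A\<^esub> f x"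
  using assms by (auto simp: algebra_Aut_def simp del: A_simps)

text \<open>The left nucleus is defined by the multiplication, so \<open>f\<close> preserves it and
  restricts to some \<open>\<tau>\<close> on \<open>L\<close>. The image \<open>k + l z\<close> of
  \<open>z\<close> is then constrained by two products in the algebra.\<close>

lemma Aut_imp_twist:
  assumes f: "f \<in> carrier Aut"
  obtains \<tau> l where "\<tau> \<in> {\<lambda>x. x, \<sigma>}" "l \<in> carrier L" "l \<otimes> \<sigma> l \<otimes> a = \<tau> a" "f = twist \<tau> l"
proof -
  note hom = AutD(1)[OF f] and Bij = AutD(2)[OF f] and lin = AutD(3)[OF f]
  note mult = ring_hom_mult[OF hom] and add = ring_hom_add[OF hom] and closed = ring_hom_closed[OF hom]
  \<comment> \<open>To place \<open>f (x, \<zero>)\<close> in the left nucleus, it must associate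
    with all \<open>v\<close> and \<open>w\<close>; these are written as images under
    \<open>f\<close>.\<close>
  have surj: "\<exists>v'\<in>carrier A. v = f v'" if "v \<in> carrier A" for v
    using Bij that unfolding Bij_def bij_betw_def by blast
  have mem: "u \<otimes>\<^bsub>A\<^esub> v \<in> carrier A" if "u \<in> carrier A" "v \<in> carrier A" for u v
    using that by (cases u; cases v) simp
  define \<tau> where "\<tau> x = fst (f (x, \<zero>))" for x
  have f_L: "f (x, \<zero>) = (\<tau> x, \<zero>)" and \<tau>_closed: "\<tau> x \<in> carrier L" if x: "x \<in> carrier L" for x
  proof -
    have xA: "(x, \<zero>) \<in> carrier A" using x by simp
    have "(f (x, \<zero>) \<otimes>\<^bsub>A\<^esub> v) \<otimes>\<^bsub>A\<^esub> w = f (x, \<zero>) \<otimes>\<^bsub>A\<^esub> (v \<otimes>\<^bsub>A\<^esub> w)"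
      if v: "v \<in> carrier A" and w: "w \<in> carrier A" for v w
    proof -
      obtain v' where v': "v' \<in> carrier A" "v = f v'"
        using surj[OF v] by blast
      obtain w' where w': "w' \<in> carrier A" "w = f w'"
        using surj[OF w] by blast
      have "((x, \<zero>) \<otimes>\<^bsub>A\<^esub> v') \<otimes>\<^bsub>A\<^esub> w' = (x, \<zero>) \<otimes>\<^bsub>A\<^esub> (v' \<otimes>\<^bsub>A\<^esub> w')"
        using iffD2[OF left_nucleus_iff[OF xA] snd_conv] v'(1) w'(1) by blast
      then have "f (((x, \<zero>) \<otimes>\<^bsub>A\<^esub> v') \<otimes>\<^bsub>A\<^esub> w') = f ((x, \<zero>) \<otimes>\<^bsub>A\<^esub> (v' \<otimes>\<^bsub>A\<^esub> w'))"
        by simp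
      then show ?thesis
        using v' w' xA by (simp only: mult mem)
    qed
    then have "snd (f (x, \<zero>)) = \<zero>"
      using left_nucleus_iff[OF closed[OF xA]] by blast
    then show "f (x, \<zero>) = (\<tau> x, \<zero>)"
      by (metis \<tau>_def prod.collapse)
    show "\<tau> x \<in> carrier L"
      using closed[OF xA] by (auto simp: \<tau>_def)
  qed
  have \<tau>_hom: "\<tau> \<in> ring_hom L L"
  proof (rule ring_hom_memI)
    fix x y assume xy: "x \<in> carrier L" "y \<in> carrier L"
    show "\<tau> (x \<otimes> y) = \<tau> x \<otimes> \<tau> y"
      using mult[of "(x, \<zero>)" "(y, \<zero>)"] xy by (simp add: f_L \<tau>_closed)
    show "\<tau> (x \<oplus> y) = \<tau> x \<oplus> \<tau> y"
      using add[of "(x, \<zero>)" "(y, \<zero>)"] xy by (simp add: f_L \<tau>_closed)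
  next
    show "\<tau> \<one> = \<one>"
      using ring_hom_one[OF hom] by (simp add: f_L)
  qed (rule \<tau>_closed)
  have "\<tau> c = c" if c: "c \<in> F" for c
  proof -
    have "f (\<one>, \<zero>) = (\<one>, \<zero>)" using ring_hom_one[OF hom] by simp
    then show ?thesis
      using lin[OF c, of "(\<one>, \<zero>)"] F_carrier[OF c] by (simp add: f_L)
  qed
  then have "(\<forall>x\<in>carrier L. \<tau> x = x) \<or> (\<forall>x\<in>carrier L. \<tau> x = \<sigma> x)"
    by (rule automorphism_cases[OF \<tau>_hom])
  \<comment> \<open>The function \<open>\<tau>\<close> read off from \<open>f\<close> is controlled
    only on \<open>carrier L\<close>; \<open>\<rho>\<close> is literally one of the two functions
    named in the conclusion.\<close>
  then obtain \<rho> where \<rho>: "\<rho> \<in> {\<lambda>x. x, \<sigma>}" and \<tau>\<rho>: "\<And>x. x \<in> carrier L \<Longrightarrow> \<tau> x = \<rho> x"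
    by blast
  obtain k l where kl: "f (\<zero>, \<one>) = (k, l)" by (rule prod.exhaust)
  have klc: "k \<in> carrier L" "l \<in> carrier L"
    using closed[of "(\<zero>, \<one>)"] by (simp_all add: kl)
  \<comment> \<open>The relation \<open>z a = \<sigma>(a) z\<close> forces
    \<open>k = \<zero>\<close>, because \<open>\<tau>\<close> separates \<open>a\<close> from
    \<open>\<sigma> a\<close>.\<close>
  have "f ((\<zero>, \<one>) \<otimes>\<^bsub>A\<^esub> (a, \<zero>)) = f ((\<sigma> a, \<zero>) \<otimes>\<^bsub>A\<^esub> (\<zero>, \<one>))"
    by simp
  then have "(k, l) \<otimes>\<^bsub>A\<^esub> (\<tau> a, \<zero>) = (\<tau> (\<sigma> a), \<zero>) \<otimes>\<^bsub>A\<^esub> (k, l)"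
    using mult[of "(\<zero>, \<one>)" "(a, \<zero>)"] mult[of "(\<sigma> a, \<zero>)" "(\<zero>, \<one>)"] by (simp add: f_L kl del: A_simps(2))
  then have "k \<otimes> \<tau> a = k \<otimes> \<tau> (\<sigma> a)"
    using klc \<tau>_closed by (simp add: m_comm)
  moreover have "\<tau> a \<noteq> \<tau> (\<sigma> a)"
    using \<rho> by (auto simp: \<tau>\<rho>)
  ultimately have k: "k = \<zero>"
    using klc \<tau>_closed[of a] \<tau>_closed[of "\<sigma> a"] m_lcancel[of k "\<tau> a" "\<tau> (\<sigma> a)"] by auto
  \<comment> \<open>The relation \<open>z z = a\<close> yields the norm condition on
    \<open>l\<close>.\<close>
  have "f ((\<zero>, \<one>) \<otimes>\<^bsub>A\<^esub> (\<zero>, \<one>)) = (\<zero>, l) \<otimes>\<^bsub>A\<^esub> (\<zero>, l)"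
    using mult[of "(\<zero>, \<one>)" "(\<zero>, \<one>)"] by (simp add: kl k del: A_simps(2))
  then have "l \<otimes> \<sigma> l \<otimes> a = \<rho> a"
    using klc by (simp add: f_L \<tau>\<rho>)
  moreover have "f = twist \<rho> l"
  proof (rule extensionalityI)
    show "f \<in> extensional (carrier A)" using Bij by (rule Bij_imp_extensional)
    show "twist \<rho> l \<in> extensional (carrier A)" by (simp add: twist_def)
    fix x assume "x \<in> carrier A"
    then obtain x0 x1 where x: "x = (x0, x1)" "x0 \<in> carrier L" "x1 \<in> carrier L" by auto
    have "f ((x1, \<zero>) \<otimes>\<^bsub>A\<^esub> (\<zero>, \<one>)) = (\<tau> x1, \<zero>) \<otimes>\<^bsub>A\<^esub> (\<zero>, l)"
      using mult[of "(x1, \<zero>)" "(\<zero>, \<one>)"] x by (simp add: kl k f_L del: A_simps(2))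
    then have "f (\<zero>, x1) = (\<zero>, \<tau> x1 \<otimes> l)"
      using x klc \<tau>_closed by simp
    then have "f ((x0, \<zero>) \<oplus>\<^bsub>A\<^esub> (\<zero>, x1)) = (\<tau> x0, \<tau> x1 \<otimes> l)"
      using add[of "(x0, \<zero>)" "(\<zero>, x1)"] x klc \<tau>_closed by (simp add: f_L)
    then show "f x = twist \<rho> l x"
      using x by (simp add: twist_apply \<tau>\<rho>)
  qed
  ultimately show thesis using that \<rho> klc by blast
qed

lemma twist_in_Aut:
  assumes \<tau>: "\<tau> \<in> {\<lambda>x. x, \<sigma>}" and l: "l \<in> carrier L" and norm: "l \<otimes> \<sigma> l \<otimes> a = \<tau> a"
  shows "twist \<tau> l \<in> carrier Aut"
proof -
  have \<tau>_hom: "\<tau> \<in> ring_hom L L"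
    using \<tau> sigma_hom by (auto intro!: ring_hom_memI)
  have \<tau>_comm: "\<tau> (\<sigma> x) = \<sigma> (\<tau> x)" and \<tau>_invol: "\<tau> (\<tau> x) = x" if "x \<in> carrier L" for x
    using \<tau> that by auto
  have \<tau>_F: "\<tau> c = c" if "c \<in> F" for c
    using \<tau> that by auto
  note c = ring_hom_closed[OF \<tau>_hom] and hom = ring_hom_mult[OF \<tau>_hom] ring_hom_add[OF \<tau>_hom]
  have "\<tau> a \<noteq> \<zero>" using \<tau> by (auto simp: sigma_eq_zero)
  then have l0: "l \<noteq> \<zero>" using norm by auto
  have maps: "twist \<tau> l x \<in> carrier A" if "x \<in> carrier A" for x
  proof -
    obtain x0 x1 where x: "x = (x0, x1)" "x0 \<in> carrier L" "x1 \<in> carrier L"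
      using \<open>x \<in> carrier A\<close> by auto
    then show ?thesis
      using l c[of x0] c[of x1] by (simp add: twist_apply)
  qed
  have "twist \<tau> l \<in> ring_hom A A"
  proof (rule ring_hom_memI)
    fix x y assume "x \<in> carrier A" "y \<in> carrier A"
    then obtain x0 x1 y0 y1 where xy: "x = (x0, x1)" "y = (y0, y1)"
      and L: "x0 \<in> carrier L" "x1 \<in> carrier L" "y0 \<in> carrier L" "y1 \<in> carrier L"
      by auto
    show "twist \<tau> l (x \<oplus>\<^bsub>A\<^esub> y) = twist \<tau> l x \<oplus>\<^bsub>A\<^esub> twist \<tau> l y"
      using L l c by (simp add: xy twist_apply hom l_distr)
    have L': "\<tau> x0 \<in> carrier L" "\<tau> x1 \<in> carrier L" "\<sigma> (\<tau> y0) \<in> carrier L" "\<tau> y1 \<in> carrier L"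
      "\<sigma> (\<tau> y1) \<in> carrier L" "\<sigma> l \<in> carrier L" "\<tau> y0 \<in> carrier L"
      using L l c by simp_all
    \<comment> \<open>The norm condition matches the terms coming from \<open>z z = a\<close>: one
      side produces \<open>\<tau>(a)\<close>, the other \<open>l \<sigma>(l) a\<close>.\<close>
    have "\<tau> x1 \<otimes> \<sigma> (\<tau> y1) \<otimes> \<tau> a = \<tau> x1 \<otimes> l \<otimes> (\<sigma> (\<tau> y1) \<otimes> \<sigma> l) \<otimes> a"
      unfolding norm[symmetric] using L' l a_simps(1) by algebra
    moreover have "(\<tau> x0 \<otimes> \<tau> y1 \<oplus> \<tau> x1 \<otimes> \<sigma> (\<tau> y0)) \<otimes> l
        = \<tau> x0 \<otimes> (\<tau> y1 \<otimes> l) \<oplus> \<tau> x1 \<otimes> l \<otimes> \<sigma> (\<tau> y0)"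
      using L' l by algebra
    ultimately show "twist \<tau> l (x \<otimes>\<^bsub>A\<^esub> y) = twist \<tau> l x \<otimes>\<^bsub>A\<^esub> twist \<tau> l y"
      using L L' l c by (simp add: xy twist_apply hom \<tau>_comm)
  next
    show "twist \<tau> l \<one>\<^bsub>A\<^esub> = \<one>\<^bsub>A\<^esub>"
      using l by (simp add: twist_apply \<tau>_F F_closed)
  qed (rule maps)
  moreover have "inj_on (twist \<tau> l) (carrier A)"
  proof (rule inj_onI)
    fix x y assume "x \<in> carrier A" "y \<in> carrier A" and eq: "twist \<tau> l x = twist \<tau> l y"
    then obtain x0 x1 y0 y1 where xy: "x = (x0, x1)" "y = (y0, y1)"
      and L: "x0 \<in> carrier L" "x1 \<in> carrier L" "y0 \<in> carrier L" "y1 \<in> carrier L"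
      by auto
    have "\<tau> x0 = \<tau> y0" "\<tau> x1 = \<tau> y1"
      using eq L l l0 c by (simp_all add: xy twist_apply m_rcancel)
    then show "x = y"
      using L xy \<tau>_invol by metis
  qed
  \<comment> \<open>The algebra is finite, so an injective self-map is bijective.\<close>
  then have "bij_betw (twist \<tau> l) (carrier A) (carrier A)"
    using endo_inj_surj[of "carrier A" "twist \<tau> l"] maps card_carrier(1)[OF finite_F nontrivial]
    by (auto simp: bij_betw_def)
  then have "twist \<tau> l \<in> Bij (carrier A)"
    by (simp add: Bij_def twist_def)
  moreover have "twist \<tau> l (c \<odot>\<^bsub>A\<^esub> x) = c \<odot>\<^bsub>A\<^esub> twist \<tau> l x" if "c \<in> F" "x \<in> carrier A" for c x
  proof -
    obtain x0 x1 where "x = (x0, x1)" "x0 \<in> carrier L" "x1 \<in> carrier L"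
      using \<open>x \<in> carrier A\<close> by auto
    then show ?thesis
      using \<open>c \<in> F\<close> F_carrier[of c] l c by (simp add: twist_apply hom \<tau>_F m_assoc)
  qed
  ultimately show ?thesis
    by (simp add: algebra_Aut_def del: A_simps)
qed


section \<open>Composition of twists and the elements of the automorphism group\<close>

lemma twist_mult:
  assumes "twist \<tau> l \<in> carrier Aut" "twist \<tau>' l' \<in> carrier Aut"
    and \<tau>: "\<tau> \<in> {\<lambda>x. x, \<sigma>}" "\<tau>' \<in> {\<lambda>x. x, \<sigma>}" and l: "l \<in> carrier L" "l' \<in> carrier L"
  shows "twist \<tau> l \<otimes>\<^bsub>Aut\<^esub> twist \<tau>' l' = twist (\<lambda>x. \<tau> (\<tau>' x)) (\<tau> l' \<otimes> l)"
proof -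
  have "twist \<tau> l \<otimes>\<^bsub>Aut\<^esub> twist \<tau>' l' = compose (carrier A) (twist \<tau> l) (twist \<tau>' l')"
    using AutD(2)[OF assms(1)] AutD(2)[OF assms(2)]
    by (simp add: algebra_Aut_def BijGroup_def del: A_simps)
  \<comment> \<open>The inner map sends \<open>z\<close> to \<open>l' z\<close>, which the outer one
    sends to \<open>\<tau>(l') l z\<close>.\<close>
  also have "\<dots> = twist (\<lambda>x. \<tau> (\<tau>' x)) (\<tau> l' \<otimes> l)"
  proof (rule extensionalityI)
    fix x assume x: "x \<in> carrier A"
    then obtain x0 x1 where x01: "x = (x0, x1)" "x0 \<in> carrier L" "x1 \<in> carrier L" by auto
    show "compose (carrier A) (twist \<tau> l) (twist \<tau>' l') x = twist (\<lambda>x. \<tau> (\<tau>' x)) (\<tau> l' \<otimes> l) x"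
      using x x01 l \<tau> by (auto simp: compose_eq twist_apply m_assoc)
  qed (simp_all add: twist_def)
  finally show ?thesis .
qed

text \<open>Used to replace the composite of \<open>\<sigma>\<close> with itself, known to be the
  identity only on \<open>carrier L\<close>, by \<open>\<lambda>x. x\<close>.\<close>

lemma twist_cong: "(\<And>x. x \<in> carrier L \<Longrightarrow> \<tau> x = \<tau>' x) \<Longrightarrow> twist \<tau> l = twist \<tau>' l"
  unfolding twist_def by (rule restrict_ext) auto

lemma twist_inj:
  assumes "twist \<tau> l = twist \<tau>' l'" "l \<in> carrier L" "l' \<in> carrier L" "\<tau> \<one> = \<one>" "\<tau>' \<one> = \<one>"
  shows "l = l'"
  using fun_cong[OF assms(1), of "(\<one>, \<one>)"] assms(2-) by (simp add: twist_apply)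

lemma twist_id_neq_twist_sigma: "twist (\<lambda>x. x) l \<noteq> twist \<sigma> l'"
proof
  assume "twist (\<lambda>x. x) l = twist \<sigma> l'"
  from fun_cong[OF this, of "(a, \<zero>)"] show False by (simp add: twist_apply)
qed

text \<open>The constants \<open>l\<close> for which \<open>\<sigma>\<close> extends to an
  automorphism sending \<open>z\<close> to \<open>l z\<close>. Whether any exist decides between the
  two groups.\<close>

definition twisted_norms :: "'a set" where
  "twisted_norms = {l \<in> carrier L. l \<otimes> \<sigma> l \<otimes> a = \<sigma> a}"

lemma carrier_Aut:
  "carrier Aut = twist (\<lambda>x. x) ` norm_one \<union> twist \<sigma> ` twisted_norms"
proof -
  \<comment> \<open>For the identity on \<open>L\<close>, cancelling the nonzero \<open>a\<close>
    turns the norm condition into norm one.\<close>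
  have norm_one_iff: "l \<in> norm_one \<longleftrightarrow> l \<otimes> \<sigma> l \<otimes> a = a" if l: "l \<in> carrier L" for l
  proof -
    have "l \<otimes> \<sigma> l \<otimes> a = a \<longleftrightarrow> l \<otimes> \<sigma> l \<otimes> a = \<one> \<otimes> a" by simp
    also have "\<dots> \<longleftrightarrow> l \<otimes> \<sigma> l = \<one>"
      using l by (intro m_rcancel) simp_all
    finally show ?thesis using l by (simp add: norm_one_def)
  qed
  show ?thesis
  proof
    show "carrier Aut \<subseteq> twist (\<lambda>x. x) ` norm_one \<union> twist \<sigma> ` twisted_norms"
    proof
      fix f assume "f \<in> carrier Aut"
      then obtain \<tau> l where \<tau>: "\<tau> \<in> {\<lambda>x. x, \<sigma>}" and l: "l \<in> carrier L" "l \<otimes> \<sigma> l \<otimes> a = \<tau> a"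
        and f: "f = twist \<tau> l"
        by (rule Aut_imp_twist)
      from \<tau> consider "\<tau> = (\<lambda>x. x)" | "\<tau> = \<sigma>" by blast
      then show "f \<in> twist (\<lambda>x. x) ` norm_one \<union> twist \<sigma> ` twisted_norms"
      proof cases
        case 1
        then have "l \<in> norm_one" using l norm_one_iff by blast
        then show ?thesis using f 1 by blast
      next
        case 2
        then have "l \<in> twisted_norms" using l by (simp add: twisted_norms_def)
        then show ?thesis using f 2 by blast
      qed
    qed
    have "twist (\<lambda>x. x) l \<in> carrier Aut" if "l \<in> norm_one" for l
      using that norm_one_iff[of l] norm_one_carrier[of l] by (intro twist_in_Aut) simp_all
    moreover have "twist \<sigma> l \<in> carrier Aut" if "l \<in> twisted_norms" for l
      using that by (intro twist_in_Aut) (simp_all add: twisted_norms_def)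
    ultimately show "twist (\<lambda>x. x) ` norm_one \<union> twist \<sigma> ` twisted_norms \<subseteq> carrier Aut"
      by blast
  qed
qed

lemma twist_id_in_Aut: "l \<in> norm_one \<Longrightarrow> twist (\<lambda>x. x) l \<in> carrier Aut"
  and twist_sigma_in_Aut: "l \<in> twisted_norms \<Longrightarrow> twist \<sigma> l \<in> carrier Aut"
  unfolding carrier_Aut by blast+

lemma twisted_norms_carrier: "l \<in> twisted_norms \<Longrightarrow> l \<in> carrier L"
  by (simp add: twisted_norms_def)

lemma inj_twist: "inj_on (twist (\<lambda>x. x)) norm_one" "inj_on (twist \<sigma>) twisted_norms"
  by (rule inj_onI, rule twist_inj, assumption, simp_all add: norm_one_carrier twisted_norms_carrier)+

text \<open>Composition multiplies the constants in reversed order, which is harmless since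
  \<open>L\<close> is commutative.\<close>

lemma twist_id_hom: "twist (\<lambda>x. x) \<in> hom norm_one_group Aut"
proof (rule homI)
  fix u v assume uv: "u \<in> carrier norm_one_group" "v \<in> carrier norm_one_group"
  then have c: "u \<in> carrier L" "v \<in> carrier L" by (simp_all add: norm_one_carrier)
  have "twist (\<lambda>x. x) u \<otimes>\<^bsub>Aut\<^esub> twist (\<lambda>x. x) v = twist (\<lambda>x. x) (v \<otimes> u)"
    using uv c by (intro twist_mult twist_id_in_Aut) simp_all
  then show "twist (\<lambda>x. x) (u \<otimes>\<^bsub>norm_one_group\<^esub> v) = twist (\<lambda>x. x) u \<otimes>\<^bsub>Aut\<^esub> twist (\<lambda>x. x) v"
    using c by (simp add: m_comm)
qed (simp add: twist_id_in_Aut)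

lemma twist_id_pow:
  "l \<in> norm_one \<Longrightarrow> twist (\<lambda>x. x) l [^]\<^bsub>Aut\<^esub> (k::nat) = twist (\<lambda>x. x) (l [^]\<^bsub>norm_one_group\<^esub> k)"
  using hom_nat_pow[OF twist_id_hom _ group_norm_one group_Aut, of l k] by simp

section \<open>The cyclic case and the dicyclic case\<close>

lemma cyclic_Aut:
  assumes "twisted_norms = {}"
  shows "cyclic_group Aut" "order Aut = card F + 1"
proof -
  interpret N: group norm_one_group by (rule group_norm_one)
  have "twist (\<lambda>x. x) \<in> epi norm_one_group Aut"
    using twist_id_hom assms unfolding epi_def carrier_Aut norm_one_group_simps by blast
  then show "cyclic_group Aut"
    by (rule N.cyclic_group_epimorphic_image[OF _ norm_one_structure(3)[OF finite_F] group_Aut])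
  show "order Aut = card F + 1"
    using card_image[OF inj_twist(1)] norm_one_structure(2)[OF finite_F] assms
    unfolding order_def carrier_Aut by simp
qed

text \<open>Such an \<open>m\<close> satisfies \<open>\<sigma>(a) = m \<sigma>(m) a\<close> with \<open>m \<sigma>(m) \<in> F\<close>; applying \<open>\<sigma>\<close> squares it to one.\<close>

lemma twisted_norm_eq:
  assumes m: "m \<in> twisted_norms"
  shows "m \<otimes> \<sigma> m = \<ominus> \<one>"
proof -
  define c where "c = m \<otimes> \<sigma> m"
  have mc: "m \<in> carrier L" "\<sigma> m \<in> carrier L" using twisted_norms_carrier[OF m] by simp_all
  have c: "c \<in> carrier L" "\<sigma> c = c" "c \<otimes> a = \<sigma> a"
    using m mc by (simp_all add: c_def twisted_norms_def m_comm)
  have "a = \<sigma> (c \<otimes> a)" by (simp only: c(3) sigma_sigma a_simps)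
  also have "\<dots> = c \<otimes> \<sigma> a"
    using c(1,2) by simp
  also have "\<dots> = (c \<otimes> c) \<otimes> a"
    using c(1) by (simp add: m_assoc flip: c(3))
  finally have "(c \<otimes> c) \<otimes> a = \<one> \<otimes> a" by simp
  then have "c \<otimes> c = \<one> \<otimes> \<one>"
    using c(1) m_rcancel[of a "c \<otimes> c" \<one>] by simp
  then have "c = \<one> \<or> c = \<ominus> \<one>"
    by (intro square_eq_imp) (simp_all add: c(1))
  \<comment> \<open>The value \<open>\<one>\<close> would give \<open>\<sigma> a = a\<close>,
    although \<open>a\<close> lies outside \<open>F\<close>.\<close>
  moreover have "c \<noteq> \<one>"
    using c(3) by auto
  ultimately show ?thesis by (simp add: c_def)
qed

text \<open>All twisted norms have norm \<open>\<ominus> \<one>\<close>, so the quotient of any two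
  has norm one: they form a coset of \<open>norm_one\<close>.\<close>

lemma card_twisted_norms:
  assumes m: "m \<in> twisted_norms"
  shows "twisted_norms = (\<lambda>u. m \<otimes> u) ` norm_one" "card twisted_norms = card norm_one"
proof -
  have mc: "m \<in> carrier L" "\<sigma> m \<in> carrier L" using twisted_norms_carrier[OF m] by simp_all
  have "\<sigma> a \<noteq> \<zero>" by (simp add: sigma_eq_zero)
  then have m0: "m \<noteq> \<zero>" using m by (auto simp: twisted_norms_def)
  have U: "m \<in> Units L" using mc m0 by (simp add: field_Units)
  show img: "twisted_norms = (\<lambda>u. m \<otimes> u) ` norm_one"
  proof
    show "(\<lambda>u. m \<otimes> u) ` norm_one \<subseteq> twisted_norms"
    proof clarify
      fix u assume u: "u \<in> norm_one"
      then have uc: "u \<in> carrier L" "u \<otimes> \<sigma> u = \<one>" by (simp_all add: norm_one_def)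
      have "(m \<otimes> u) \<otimes> \<sigma> (m \<otimes> u) = m \<otimes> \<sigma> m"
        using norm_mult[OF mc(1) uc(1)] uc mc by simp
      then show "m \<otimes> u \<in> twisted_norms"
        using m uc mc by (simp add: twisted_norms_def)
    qed
    show "twisted_norms \<subseteq> (\<lambda>u. m \<otimes> u) ` norm_one"
    proof
      fix l assume l: "l \<in> twisted_norms"
      then have lc: "l \<in> carrier L" by (rule twisted_norms_carrier)
      define u where "u = inv m \<otimes> l"
      have uc: "u \<in> carrier L" using U lc by (simp add: u_def)
      have l_eq: "l = m \<otimes> u"
        using U lc mc by (simp add: u_def flip: m_assoc)
      have "(m \<otimes> \<sigma> m) \<otimes> (u \<otimes> \<sigma> u) = m \<otimes> \<sigma> m"
        using norm_mult[OF mc(1) uc] twisted_norm_eq[OF l] twisted_norm_eq[OF m] unfolding l_eq by simp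
      then have "\<ominus> (u \<otimes> \<sigma> u) = \<ominus> \<one>"
        using uc unfolding twisted_norm_eq[OF m] by (simp add: l_minus)
      then have "\<ominus> (\<ominus> (u \<otimes> \<sigma> u)) = \<ominus> (\<ominus> \<one>)" by (rule arg_cong)
      then have "u \<otimes> \<sigma> u = \<one>" using uc by simp
      then show "l \<in> (\<lambda>u. m \<otimes> u) ` norm_one"
        using uc l_eq by (auto simp: norm_one_def)
    qed
  qed
  have "inj_on (\<lambda>u. m \<otimes> u) norm_one"
    using mc m0 by (auto intro!: inj_onI simp: m_lcancel norm_one_carrier)
  then show "card twisted_norms = card norm_one"
    unfolding img by (rule card_image)
qed

lemma norm_one_generator:
  obtains g where "g \<in> norm_one" "group.ord norm_one_group g = card F + 1"
    "norm_one \<subseteq> range (\<lambda>k::nat. g [^]\<^bsub>norm_one_group\<^esub> k)"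
proof -
  interpret N: group norm_one_group by (rule group_norm_one)
  obtain g where g: "g \<in> carrier norm_one_group" "subgroup_generated norm_one_group {g} = norm_one_group"
    using norm_one_structure(3)[OF finite_F] unfolding cyclic_group_def by blast
  have "N.ord g = card F + 1"
    using N.cyclic_order_is_ord[OF g(1)] g(2) norm_one_structure(2)[OF finite_F]
    by (simp add: order_def)
  moreover have "generate norm_one_group {g} = norm_one"
    using arg_cong[OF g(2), of carrier] g(1)
    by (simp add: carrier_subgroup_generated)
  then have "norm_one \<subseteq> range (\<lambda>k::nat. g [^]\<^bsub>norm_one_group\<^esub> k)"
    using N.generate_pow_on_finite_carrier[OF _ g(1)] norm_one_structure(1)[OF finite_F]
    unfolding norm_one_group_simps by blast
  ultimately show thesis using that g(1) by simp
qed

text \<open>The element \<open>\<ominus> \<one>\<close> has norm one and order two, so by Lagrange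
  the group order is even. The half power of \<open>g\<close> squares to one but is not one, its
  exponent being positive and below the order of \<open>g\<close>; a field leaves only
  \<open>\<ominus> \<one>\<close>.\<close>

lemma norm_one_half_power:
  assumes g: "g \<in> norm_one" and ord: "group.ord norm_one_group g = card F + 1"
  shows "even (card F + 1)" "g [^]\<^bsub>norm_one_group\<^esub> ((card F + 1) div 2) = \<ominus> \<one>"
proof -
  interpret N: group norm_one_group by (rule group_norm_one)
  have neg: "\<ominus> \<one> \<in> norm_one"
    by (simp add: norm_one_def l_minus r_minus)
  have neg_neq: "\<ominus> \<one> \<noteq> \<one>"
    using two_neq_zero by (metis one_closed r_neg)
  have neg_sq: "(\<ominus> \<one>) [^]\<^bsub>norm_one_group\<^esub> (2::nat) = \<one>"
    by (simp add: numeral_2_eq_2 l_minus r_minus)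
  then have "N.ord (\<ominus> \<one>) dvd 2"
    using N.pow_eq_id[of "\<ominus> \<one>" 2] neg by simp
  moreover have "N.ord (\<ominus> \<one>) \<noteq> 1"
    using N.ord_eq_1[of "\<ominus> \<one>"] neg neg_neq by simp
  ultimately have "N.ord (\<ominus> \<one>) = 2"
    using prime_nat_iff two_is_prime_nat by blast
  then show even: "even (card F + 1)"
    using N.ord_dvd_group_order[of "\<ominus> \<one>"] neg norm_one_structure(2)[OF finite_F]
    by (simp add: order_def)
  define n where "n = (card F + 1) div 2"
  define w where "w = g [^]\<^bsub>norm_one_group\<^esub> n"
  have "card F + 1 = n * 2"
    unfolding n_def using dvd_div_mult_self[OF even, symmetric] .
  then have n2: "card F + 1 = n * 2" "n < card F + 1" "0 < n"
    by simp_all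
  have w: "w \<in> norm_one" unfolding w_def using N.nat_pow_closed[of g n] g by simp
  have "w [^]\<^bsub>norm_one_group\<^esub> (2::nat) = g [^]\<^bsub>norm_one_group\<^esub> (n * 2)"
    unfolding w_def using N.nat_pow_pow[of g n 2] g by simp
  also have "\<dots> = \<one>"
    using N.pow_ord_eq_1[of g] g unfolding n2(1)[symmetric] ord[symmetric] by simp
  finally have "w [^]\<^bsub>norm_one_group\<^esub> (2::nat) = \<one>" .
  then have "w \<otimes> w = \<one> \<otimes> \<one>"
    using w norm_one_carrier by (simp add: numeral_2_eq_2)
  then have "w = \<one> \<or> w = \<ominus> \<one>"
    by (intro square_eq_imp) (simp_all add: norm_one_carrier[OF w])
  moreover have "w \<noteq> \<one>"
    unfolding w_def using N.pow_eq_id[of g n] g ord n2 by (auto dest: dvd_imp_le)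
  ultimately show "g [^]\<^bsub>norm_one_group\<^esub> ((card F + 1) div 2) = \<ominus> \<one>"
    by (simp add: w_def n_def)
qed

lemma dicyclic_Aut:
  assumes m: "m \<in> twisted_norms"
  shows "Aut \<cong> dicyclic_group ((card F + 1) div 2)" "order Aut = 2 * card F + 2"
proof -
  interpret N: group norm_one_group by (rule group_norm_one)
  interpret G: group Aut by (rule group_Aut)
  have mc: "m \<in> carrier L" "\<sigma> m \<in> carrier L" using twisted_norms_carrier[OF m] by simp_all
  note fin = norm_one_structure(1)[OF finite_F] and card = norm_one_structure(2)[OF finite_F]
  obtain g where g: "g \<in> norm_one" and ord: "N.ord g = card F + 1"
    and powers: "norm_one \<subseteq> range (\<lambda>k::nat. g [^]\<^bsub>norm_one_group\<^esub> k)"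
    by (rule norm_one_generator)
  have gc: "g \<in> carrier L" "\<sigma> g \<in> carrier L" "g \<otimes> \<sigma> g = \<one>"
    using g by (simp_all add: norm_one_def)
  define n where "n = (card F + 1) div 2"
  have n: "2 * n = card F + 1" "0 < n"
    using norm_one_half_power(1)[OF g ord] by (simp_all add: n_def)
  define x where "x = twist \<sigma> m"
  define y where "y = twist (\<lambda>x. x) g"
  have x: "x \<in> carrier Aut" and y: "y \<in> carrier Aut"
    by (simp_all add: x_def y_def twist_sigma_in_Aut[OF m] twist_id_in_Aut[OF g])
  have one: "\<one>\<^bsub>Aut\<^esub> = twist (\<lambda>x. x) \<one>"
    using hom_one[OF twist_id_hom group_norm_one group_Aut] by simp
  have y_pow: "y [^]\<^bsub>Aut\<^esub> k = twist (\<lambda>x. x) (g [^]\<^bsub>norm_one_group\<^esub> k)" for k :: nat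
    unfolding y_def by (rule twist_id_pow[OF g])
  have y_2n: "y [^]\<^bsub>Aut\<^esub> (2 * n) = \<one>\<^bsub>Aut\<^esub>"
    using N.pow_ord_eq_1[of g] g unfolding y_pow one n(1) ord by simp
  \<comment> \<open>The square of \<open>x\<close> is trivial on \<open>L\<close> and sends
    \<open>z\<close> to \<open>\<sigma>(m) m z = - z\<close>; so does the \<open>n\<close>-th power
    of \<open>y\<close>, by the half power of \<open>g\<close>.\<close>
  have "x \<otimes>\<^bsub>Aut\<^esub> x = twist (\<lambda>x. \<sigma> (\<sigma> x)) (\<sigma> m \<otimes> m)"
    unfolding x_def using mc by (intro twist_mult twist_sigma_in_Aut m) simp_all
  also have "\<dots> = twist (\<lambda>x. x) (\<sigma> m \<otimes> m)"
    by (rule twist_cong) (rule sigma_sigma)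
  also have "\<sigma> m \<otimes> m = \<ominus> \<one>"
    unfolding m_comm[OF mc(2,1)] by (rule twisted_norm_eq[OF m])
  also have "twist (\<lambda>x. x) (\<ominus> \<one>) = y [^]\<^bsub>Aut\<^esub> n"
    unfolding y_pow n_def norm_one_half_power(2)[OF g ord] ..
  finally have x_sq: "x \<otimes>\<^bsub>Aut\<^esub> x = y [^]\<^bsub>Aut\<^esub> n" .
  have id_sigma: "twist (\<lambda>x. x) u \<otimes>\<^bsub>Aut\<^esub> twist \<sigma> l = twist \<sigma> (l \<otimes> u)"
    if "u \<in> norm_one" "l \<in> twisted_norms" for u l
    using twist_mult[OF twist_id_in_Aut[OF that(1)] twist_sigma_in_Aut[OF that(2)]]
      norm_one_carrier[OF that(1)] twisted_norms_carrier[OF that(2)] by simp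
  \<comment> \<open>The aim is \<open>y x y = x\<close>, a rearranged conjugation relation: the
    constant becomes \<open>\<sigma>(g) m g = m\<close>, as \<open>\<sigma> g\<close> is the inverse
    of \<open>g\<close>.\<close>
  have xy: "x \<otimes>\<^bsub>Aut\<^esub> y = twist \<sigma> (\<sigma> g \<otimes> m)"
    using twist_mult[of \<sigma> m "\<lambda>x. x" g] x y mc gc by (simp add: x_def y_def)
  have "\<sigma> g \<otimes> m \<in> twisted_norms"
    using card_twisted_norms(1)[OF m] norm_one_sigma[OF g] gc mc by (auto simp: m_comm)
  then have "y \<otimes>\<^bsub>Aut\<^esub> (x \<otimes>\<^bsub>Aut\<^esub> y) = twist \<sigma> (\<sigma> g \<otimes> m \<otimes> g)"
    unfolding xy unfolding y_def by (rule id_sigma[OF g])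
  also have "\<sigma> g \<otimes> m \<otimes> g = m \<otimes> (g \<otimes> \<sigma> g)"
    using gc(1,2) mc(1) by algebra
  also have "twist \<sigma> (m \<otimes> (g \<otimes> \<sigma> g)) = x"
    using gc(3) mc by (simp add: x_def)
  finally have yxy: "y \<otimes>\<^bsub>Aut\<^esub> (x \<otimes>\<^bsub>Aut\<^esub> y) = x" .
  have conj: "inv\<^bsub>Aut\<^esub> x \<otimes>\<^bsub>Aut\<^esub> y \<otimes>\<^bsub>Aut\<^esub> x = inv\<^bsub>Aut\<^esub> y"
  proof (rule G.inv_equality[symmetric])
    have "inv\<^bsub>Aut\<^esub> x \<otimes>\<^bsub>Aut\<^esub> y \<otimes>\<^bsub>Aut\<^esub> x \<otimes>\<^bsub>Aut\<^esub> y = inv\<^bsub>Aut\<^esub> x \<otimes>\<^bsub>Aut\<^esub> (y \<otimes>\<^bsub>Aut\<^esub> (x \<otimes>\<^bsub>Aut\<^esub> y))"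
      using x y by (simp only: G.m_assoc G.m_closed G.inv_closed)
    also have "\<dots> = \<one>\<^bsub>Aut\<^esub>"
      unfolding yxy using x by (rule G.l_inv)
    finally show "inv\<^bsub>Aut\<^esub> x \<otimes>\<^bsub>Aut\<^esub> y \<otimes>\<^bsub>Aut\<^esub> x \<otimes>\<^bsub>Aut\<^esub> y = \<one>\<^bsub>Aut\<^esub>" .
  qed (use x y in \<open>simp_all only: G.m_closed G.inv_closed\<close>)
  have y_pow_gen: "y [^]\<^bsub>Aut\<^esub> k \<in> generate Aut {x, y}" for k :: nat
    by (induction k) (auto simp: nat_pow_def intro: generate.intros)
  have rot_gen: "twist (\<lambda>x. x) u \<in> generate Aut {x, y}" if "u \<in> norm_one" for u
    using powers that y_pow_gen unfolding y_pow by blast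
  have "twist \<sigma> l \<in> generate Aut {x, y}" if "l \<in> twisted_norms" for l
  proof -
    \<comment> \<open>The coset description of \<open>twisted_norms\<close> makes every twist over
      \<open>\<sigma>\<close> a twist over the identity times \<open>x\<close>.\<close>
    obtain u where u: "u \<in> norm_one" "l = m \<otimes> u"
      using \<open>l \<in> twisted_norms\<close> card_twisted_norms(1)[OF m] by blast
    have "twist (\<lambda>x. x) u \<otimes>\<^bsub>Aut\<^esub> x \<in> generate Aut {x, y}"
      by (intro generate.eng rot_gen u generate.incl) simp
    then show ?thesis
      unfolding x_def u(2) id_sigma[OF u(1) m] .
  qed
  then have gen: "carrier Aut \<subseteq> generate Aut {x, y}"
    using rot_gen unfolding carrier_Aut by blast
  have fin': "finite twisted_norms"
    unfolding card_twisted_norms(1)[OF m] using fin by (rule finite_imageI)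
  have "order Aut = card (twist (\<lambda>x. x) ` norm_one) + card (twist \<sigma> ` twisted_norms)"
    unfolding order_def carrier_Aut
    by (rule card_Un_disjoint) (use fin fin' twist_id_neq_twist_sigma in auto)
  also have "\<dots> = 2 * card F + 2"
    using card_image[OF inj_twist(1)] card_image[OF inj_twist(2)] card card_twisted_norms(2)[OF m]
    by simp
  finally show order: "order Aut = 2 * card F + 2" .
  then have "order Aut = 4 * n" using n(1) by simp
  then show "Aut \<cong> dicyclic_group ((card F + 1) div 2)"
    unfolding n_def[symmetric]
    by (rule G.iso_dicyclic_group[OF x y n(2) y_2n x_sq conj gen])
qed

end

section \<open>The dichotomy for the automorphism group over a finite field\<close>

theorem theorem3p11:
  fixes L :: "('a, 'm) ring_scheme" and F :: "'a set" and q :: nat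
    and \<sigma> :: "'a \<Rightarrow> 'a" and a :: 'a
  assumes "field L" and "subfield F L"
    and "finite F" and "card F = q"
    and "ring_char (L\<lparr>carrier := F\<rparr>) \<noteq> 2"
    and "ring.dimension L 2 F (carrier L)"
    and "\<sigma> \<in> carrier (galois_group L F)"
    and "generate (galois_group L F) {\<sigma>} = carrier (galois_group L F)"
    and "a \<in> carrier L - F"
  shows "let G = algebra_Aut (L\<lparr>carrier := F\<rparr>) (nonassoc_cyclic_algebra L \<sigma> a)
         in (cyclic_group G \<and> order G = q + 1)
          \<or> (G \<cong> dicyclic_group ((q + 1) div 2) \<and> order G = 2 * q + 2)"
proof -
  interpret L: field L by fact
  interpret K: field "L\<lparr>carrier := F\<rparr>" by (rule L.subfield_iff(2)) fact
  have two: "\<one>\<^bsub>L\<^esub> \<oplus>\<^bsub>L\<^esub> \<one>\<^bsub>L\<^esub> \<noteq> \<zero>\<^bsub>L\<^esub>"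
  proof
    \<comment> \<open>The additive order of \<open>\<one>\<close> would divide two without being
      one, so the characteristic of \<open>F\<close> would be two.\<close>
    assume sum: "\<one>\<^bsub>L\<^esub> \<oplus>\<^bsub>L\<^esub> \<one>\<^bsub>L\<^esub> = \<zero>\<^bsub>L\<^esub>"
    have "add_pow (L\<lparr>carrier := F\<rparr>) (2::nat) \<one>\<^bsub>L\<^esub> = \<zero>\<^bsub>L\<^esub>"
      using sum K.one_closed L.l_zero[OF L.one_closed]
      by (simp add: add_pow_def nat_pow_def numeral_2_eq_2)
    then have "K.add.ord \<one>\<^bsub>L\<^esub> dvd 2"
      using K.add.pow_eq_id[OF K.one_closed, of 2] by simp
    moreover have "K.add.ord \<one>\<^bsub>L\<^esub> \<noteq> 1"
      using K.add.ord_eq_1[OF K.one_closed] L.one_not_zero by simp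
    ultimately have "K.add.ord \<one>\<^bsub>L\<^esub> = 2"
      using prime_nat_iff two_is_prime_nat by blast
    then show False
      using assms(5) by (simp add: ring_char_def)
  qed
  have nontrivial: "carrier L \<noteq> F" using assms(9) by blast
  interpret quadratic_cyclic_algebra L F \<sigma> a
    by (intro quadratic_cyclic_algebra.intro quadratic_galois_extension.intro
        quadratic_extension.intro quadratic_cyclic_algebra_axioms.intro
        quadratic_galois_extension_axioms.intro quadratic_extension_axioms.intro)
      (fact assms two nontrivial)+
  \<comment> \<open>The two alternatives correspond to \<open>twisted_norms\<close> being empty or
    not.\<close>
  show ?thesis
    using cyclic_Aut dicyclic_Aut unfolding Let_def assms(4)[symmetric] by blast
qed

end
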